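(* Let $m\in\mathbb Z$ with $|m|\ge2$ and let $Z_m^\times=\{\overline{BS}(m,\xi):\xi\in\mathbb Z_m^\times\}\subseteq\mathcal G_2$. Then the Hausdorff dimension of $Z_m^\times$ with respect to the metric of $\mathcal G_2$ satisfies $$\frac{\log|m|}{2(|m|+1)}\le\dim_H(Z_m^\times)\le\frac{\log|m|}{2}.$$
   Context: $\mathbb Z_m$ is the ring of $m$-adic integers and $\mathbb Z_m^\times$ its group of units. For $p,q\in\mathbb Z\setminus\{0\}$, $BS(p,q)=\langle a,b\mid ab^pa^{-1}=b^q\rangle$, marked by $(a,b)$. $\mathcal G_2$ is the space of marked groups on two generators, i.e. normal subgroups of $\mathbb F(a,b)$, with the ultrametric $d(N_1,N_2)=e^{-\lambda}$ ($N_1\ne N_2$), $\lambda$ the minimal word length of an element of $N_1\triangle N_2$. $\overline{BS}(m,\xi)$ is the limit in $\mathcal G_2$ of $BS(m,\xi_n)$ for any sequence of integers $(\xi_n)$ with $|\xi_n|\to\infty$, $\xi_n\to\xi$ in $\mathbb Z_m$ (exists, independent of the sequence). $\log$ is the natural logarithm. *)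

theory Defs
  imports "HOL-Analysis.Analysis"
begin

text \<open>A letter is a pair (g, e): g = False means generator a, g = True means b;
  e = True means the inverse of that generator.\<close>
type_synonym letter = "bool \<times> bool"
type_synonym word = "letter list"

definition linv :: "letter \<Rightarrow> letter" where
  "linv x = (fst x, \<not> snd x)"

definition gen_a :: letter where "gen_a = (False, False)"
definition gen_b :: letter where "gen_b = (True, False)"

definition reduce :: "word \<Rightarrow> word" where
  "reduce w = foldr (\<lambda>x acc. case acc of [] \<Rightarrow> [x]
                                 | y # ys \<Rightarrow> (if y = linv x then ys else x # y # ys)) w []"

definition reduced :: "word \<Rightarrow> bool" where
  "reduced w = (\<forall>i. Suc i < length w \<longrightarrow> w ! Suc i \<noteq> linv (w ! i))"

definition wmult :: "word \<Rightarrow> word \<Rightarrow> word" where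
  "wmult u v = reduce (u @ v)"

definition winv :: "word \<Rightarrow> word" where
  "winv w = rev (map linv w)"

text \<open>Normal subgroups of F(a,b) = points of the space of marked groups G_2.\<close>
definition normal_sub :: "word set \<Rightarrow> bool" where
  "normal_sub N \<longleftrightarrow> N \<subseteq> {w. reduced w} \<and> [] \<in> N
     \<and> (\<forall>u\<in>N. \<forall>v\<in>N. wmult u v \<in> N)
     \<and> (\<forall>u\<in>N. winv u \<in> N)
     \<and> (\<forall>g. reduced g \<longrightarrow> (\<forall>n\<in>N. wmult (wmult g n) (winv g) \<in> N))"

definition marked_groups :: "word set set" where
  "marked_groups = {N. normal_sub N}"

definition normal_closure :: "word set \<Rightarrow> word set" where
  "normal_closure R = \<Inter> {N. normal_sub N \<and> R \<subseteq> N}"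

definition mg_dist :: "word set \<Rightarrow> word set \<Rightarrow> real" where
  "mg_dist N1 N2 = (if N1 = N2 then 0
     else exp (- real (LEAST k. \<exists>w. w \<in> (N1 - N2) \<union> (N2 - N1) \<and> length w = k)))"

definition wpow :: "letter \<Rightarrow> int \<Rightarrow> word" where
  "wpow x k = (if k \<ge> 0 then replicate (nat k) x else replicate (nat (- k)) (linv x))"

definition bs_relator :: "int \<Rightarrow> int \<Rightarrow> word" where
  "bs_relator p q = reduce ([gen_a] @ wpow gen_b p @ [linv gen_a] @ wpow gen_b (- q))"

definition BS :: "int \<Rightarrow> int \<Rightarrow> word set" where
  "BS p q = normal_closure {bs_relator p q}"

definition madic :: "int \<Rightarrow> (nat \<Rightarrow> int) set" where
  "madic m = {x. \<forall>k. 0 \<le> x k \<and> x k < \<bar>m\<bar> ^ k \<and> x (Suc k) mod \<bar>m\<bar> ^ k = x k}"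

definition madic_units :: "int \<Rightarrow> (nat \<Rightarrow> int) set" where
  "madic_units m = {x \<in> madic m. coprime (x 1) m}"

definition madic_tendsto :: "int \<Rightarrow> (nat \<Rightarrow> int) \<Rightarrow> (nat \<Rightarrow> int) \<Rightarrow> bool" where
  "madic_tendsto m xi x \<longleftrightarrow> (\<forall>k. eventually (\<lambda>n. xi n mod \<bar>m\<bar> ^ k = x k) sequentially)"

definition mg_tendsto :: "(nat \<Rightarrow> word set) \<Rightarrow> word set \<Rightarrow> bool" where
  "mg_tendsto Ns N \<longleftrightarrow> N \<in> marked_groups \<and> ((\<lambda>n. mg_dist (Ns n) N) \<longlonglongrightarrow> 0)"

definition barBS :: "int \<Rightarrow> (nat \<Rightarrow> int) \<Rightarrow> word set" where
  "barBS m x = (THE N. \<forall>xi. filterlim (\<lambda>n. \<bar>xi n\<bar>) at_top sequentially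
                          \<and> madic_tendsto m xi x \<longrightarrow> mg_tendsto (\<lambda>n. BS m (xi n)) N)"

definition mdiam :: "('a \<Rightarrow> 'a \<Rightarrow> real) \<Rightarrow> 'a set \<Rightarrow> ennreal" where
  "mdiam d U = (SUP x\<in>U. SUP y\<in>U. ennreal (d x y))"

text \<open>diam(U)^s with the conventions diam(emptyset)^s = 0 and diam(U)^0 = 1 for U nonempty.\<close>
definition hterm :: "('a \<Rightarrow> 'a \<Rightarrow> real) \<Rightarrow> real \<Rightarrow> 'a set \<Rightarrow> ennreal" where
  "hterm d s U = (if U = {} then 0 else if s = 0 then 1
                  else ennreal (enn2real (mdiam d U) powr s))"

definition hcontent :: "('a \<Rightarrow> 'a \<Rightarrow> real) \<Rightarrow> real \<Rightarrow> real \<Rightarrow> 'a set \<Rightarrow> ennreal" where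
  "hcontent d s \<delta> A = Inf {(\<Sum>i. hterm d s (U i)) | U :: nat \<Rightarrow> 'a set.
       A \<subseteq> (\<Union>i. U i) \<and> (\<forall>i. mdiam d (U i) \<le> ennreal \<delta>)}"

definition hmeasure :: "('a \<Rightarrow> 'a \<Rightarrow> real) \<Rightarrow> real \<Rightarrow> 'a set \<Rightarrow> ennreal" where
  "hmeasure d s A = (SUP \<delta>\<in>{0<..}. hcontent d s \<delta> A)"

definition hdim :: "('a \<Rightarrow> 'a \<Rightarrow> real) \<Rightarrow> 'a set \<Rightarrow> ereal" where
  "hdim d A = Inf {ereal s | s. 0 \<le> s \<and> hmeasure d s A = 0}"

end

theory Submission
  imports Defs
begin

text \<open>By Britton's lemma a word is trivial in BS(m, q) iff it fixes the trivial normal form. In the course of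
  rewriting a word with h letters a, for q large, one only meets powers of b whose exponents are
  integer combinations, independent of q, of 1 and of the numbers q t(i), i < h, where t(0) = 1 and t(i+1)
  is the quotient of q t(i) by m. Whether such an exponent is divisible by m depends only on the
  first h remainders, hence on q modulo m^h. Trivial words have as many letters a as inverses of a,
  so parameters that agree modulo m^h give limit groups at distance at most exp(-2h), and the natural
  covers yield the upper bound. Conversely, for units the first h remainders determine the parameter
  modulo m^h, and they can be read off from commutators with b of length about 2(|m|+1)h; a
  mass distribution argument on the tree of residues yields the lower bound.\<close>

section \<open>Words and the free group\<close>

text \<open>The gap between the two bounds is a matter of letters per level of the residue tree,
  which has |m|^h vertices at level h. To depend on level h at all, a trivial word must contain
  about h letters a and as many inverses; this gives the denominator 2. A word that really reads off
  a level also spends up to |m| - 1 letters b on each remainder and enters its commutator twice;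
  this gives 2(|m| + 1). The obstacle is that exponents of b diverge with q, so there is no limiting
  computation to carry out. They are tracked symbolically, through coefficients that do not involve
  q, and claims about them are made for large |q| in a fixed residue class. Normal forms are handled
  by letting letters act on them: that inverse letters act by inverse maps takes the place of a
  confluence argument. As m may be composite, recovering the parameter from its digits rests on a
  factor being coprime to m.\<close>

lemma linv_linv [simp]: "linv (linv x) = x"
  by (simp add: linv_def)

definition rcons :: "letter \<Rightarrow> word \<Rightarrow> word" where
  "rcons x acc = (case acc of [] \<Rightarrow> [x] | y # ys \<Rightarrow> (if y = linv x then ys else x # y # ys))"

lemma reduce_eq_foldr: "reduce w = foldr rcons w []"
  by (simp add: reduce_def rcons_def[abs_def])

lemma reduce_Nil [simp]: "reduce [] = []"
  by (simp add: reduce_eq_foldr)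

lemma reduce_Cons: "reduce (x # w) = rcons x (reduce w)"
  by (simp add: reduce_eq_foldr)

lemma reduce_append_foldr: "reduce (u @ v) = foldr rcons u (reduce v)"
  by (simp add: reduce_eq_foldr)

lemma reduced_Nil [simp]: "reduced []"
  by (simp add: reduced_def)

lemma reduced_single [simp]: "reduced [x]"
  by (simp add: reduced_def)

lemma reduced_Cons_Cons: "reduced (x # y # ys) \<longleftrightarrow> y \<noteq> linv x \<and> reduced (y # ys)"
  unfolding reduced_def by (auto simp: nth_Cons split: nat.splits)

lemma reduced_rcons: "reduced w \<Longrightarrow> reduced (rcons x w)"
  by (cases w rule: remdups_adj.cases)
    (auto simp: rcons_def reduced_Cons_Cons split: list.splits)

lemma reduced_reduce [simp]: "reduced (reduce w)"
  by (induction w) (auto simp: reduce_Cons reduced_rcons)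

lemma reduce_of_reduced: "reduced w \<Longrightarrow> reduce w = w"
proof (induction w)
  case (Cons x w)
  then show ?case
    by (cases w) (auto simp: reduce_Cons rcons_def reduced_Cons_Cons)
qed simp

lemma length_reduce_le: "length (reduce w) \<le> length w"
proof (induction w)
  case (Cons x w)
  then show ?case
    by (auto simp: reduce_Cons rcons_def split: list.splits)
qed simp

lemma foldr_preserves:
  assumes "\<And>x s. P s \<Longrightarrow> P (f x s)" "P s"
  shows "P (foldr f w s)"
  using assms by (induction w) auto

text \<open>Cancelling adjacent inverse letters does not change a composite of maps in which they
  act by inverse maps. Used with \<open>rcons\<close> on reduced words this gives associativity of
  reduced multiplication; used with \<open>act\<close> on valid states it makes the action well
  defined on the free group.\<close>

lemma foldr_reduce:
  assumes pres: "\<And>x s. P s \<Longrightarrow> P (f x s)"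
    and inv: "\<And>x s. P s \<Longrightarrow> f x (f (linv x) s) = s"
    and "P s"
  shows "foldr f (reduce w) s = foldr f w s"
proof (induction w)
  case (Cons x w)
  have "foldr f (rcons x acc) s = f x (foldr f acc s)" for acc
    using inv[OF foldr_preserves[of P f, OF pres \<open>P s\<close>]]
    by (auto simp: rcons_def split: list.splits)
  with Cons show ?case
    by (simp add: reduce_Cons)
qed simp

lemma rcons_rcons_linv: "reduced w \<Longrightarrow> rcons x (rcons (linv x) w) = w"
  by (cases w rule: remdups_adj.cases)
    (auto simp: rcons_def reduced_Cons_Cons split: list.splits)

lemma reduce_reduce_append [simp]: "reduce (reduce u @ v) = reduce (u @ v)"
  using foldr_reduce[of reduced rcons "reduce v" u]
  by (simp add: reduce_append_foldr reduced_rcons rcons_rcons_linv)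

lemma reduce_reduce [simp]: "reduce (reduce u) = reduce u"
  by (simp add: reduce_of_reduced)

lemma reduce_append_reduce [simp]: "reduce (u @ reduce v) = reduce (u @ v)"
  by (simp add: reduce_append_foldr)

lemma reduce_append_reduce_append [simp]: "reduce (u @ reduce v @ z) = reduce (u @ v @ z)"
  by (metis reduce_append_reduce reduce_reduce_append)

lemma reduce_cong: "reduce u = reduce v \<Longrightarrow> reduce (p @ u @ s) = reduce (p @ v @ s)"
  by (metis reduce_append_reduce reduce_reduce_append)

lemma reduce_cancel [simp]: "reduce (x # linv x # w) = reduce w" "reduce (linv x # x # w) = reduce w"
  using rcons_rcons_linv[of "reduce w" x] rcons_rcons_linv[of "reduce w" "linv x"]
  by (simp_all add: reduce_Cons)

lemma winv_Nil [simp]: "winv [] = []"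
  and winv_Cons: "winv (x # w) = winv w @ [linv x]"
  and winv_append: "winv (u @ v) = winv v @ winv u"
  and winv_winv [simp]: "winv (winv w) = w"
  and length_winv [simp]: "length (winv w) = length w"
  by (simp_all add: winv_def rev_map o_def)

lemma reduce_winv_cancel_right: "reduce (p @ w @ winv w @ s) = reduce (p @ s)"
proof (induction w arbitrary: p s)
  case (Cons x w)
  have "reduce (p @ (x # w) @ winv (x # w) @ s) = reduce ((p @ [x]) @ w @ winv w @ linv x # s)"
    by (simp add: winv_Cons)
  also have "\<dots> = reduce (p @ [x, linv x] @ s)"
    by (subst Cons) simp
  also have "\<dots> = reduce (p @ [] @ s)"
    by (rule reduce_cong) simp
  finally show ?case by simp
qed simp

lemma reduce_winv_cancel_left: "reduce (p @ winv w @ w @ s) = reduce (p @ s)"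
  using reduce_winv_cancel_right[of p "winv w" s] by simp

lemma reduced_winv:
  assumes "reduced u"
  shows "reduced (winv u)"
  unfolding reduced_def
proof (intro allI impI)
  fix i assume i: "Suc i < length (winv u)"
  define j where "j = length u - Suc (Suc i)"
  have j: "Suc j < length u" "length u - Suc i = Suc j"
    using i by (auto simp: j_def)
  have "winv u ! Suc i = linv (u ! j)" "winv u ! i = linv (u ! Suc j)"
    using i j by (simp_all add: winv_def rev_nth j_def)
  moreover have "u ! Suc j \<noteq> linv (u ! j)"
    using assms j by (simp add: reduced_def)
  ultimately show "winv u ! Suc i \<noteq> linv (winv u ! i)"
    by (metis linv_linv)
qed

lemma reduce_winv: "reduce (winv w) = winv (reduce w)"
proof -
  have "reduce (winv w) = reduce (winv w @ reduce w @ winv (reduce w) @ [])"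
    using reduce_winv_cancel_right[of "winv w" "reduce w" "[]"] by simp
  also have "\<dots> = reduce (winv w @ w @ winv (reduce w))"
    by simp
  also have "\<dots> = reduce (winv (reduce w))"
    using reduce_winv_cancel_left[of "[]" w] by simp
  finally show ?thesis
    by (simp add: reduce_of_reduced reduced_winv)
qed

lemma length_wpow [simp]: "length (wpow x k) = nat \<bar>k\<bar>"
  by (auto simp: wpow_def)

lemma wpow_0 [simp]: "wpow x 0 = []"
  by (simp add: wpow_def)

lemma wpow_1 [simp]: "wpow x 1 = [x]" "wpow x (-1) = [linv x]"
  by (simp_all add: wpow_def)

lemma winv_wpow [simp]: "winv (wpow x k) = wpow x (-k)"
  by (auto simp: wpow_def winv_def)

lemma reduce_wpow_step:
  "reduce (x # wpow x k @ z) = reduce (wpow x (k + 1) @ z)"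
  "reduce (linv x # wpow x k @ z) = reduce (wpow x (k - 1) @ z)"
proof -
  have A: "reduce (y # wpow y k @ z) = reduce (wpow y (k + 1) @ z)" for y k
  proof (cases "k \<ge> 0")
    case True
    then have "nat (k + 1) = Suc (nat k)" by simp
    with True show ?thesis by (simp add: wpow_def)
  next
    case False
    then have "nat (- k) = Suc (nat (- (k + 1)))" by simp
    with False show ?thesis by (auto simp: wpow_def)
  qed
  have "wpow (linv x) j = wpow x (- j)" for j
    by (auto simp: wpow_def)
  with A[of x k] A[of "linv x" "-k"] show
    "reduce (x # wpow x k @ z) = reduce (wpow x (k + 1) @ z)"
    "reduce (linv x # wpow x k @ z) = reduce (wpow x (k - 1) @ z)"
    by simp_all
qed

lemma reduce_wpow_add: "reduce (p @ wpow x j @ wpow x k @ z) = reduce (p @ wpow x (j + k) @ z)"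
proof -
  have "reduce (wpow x j @ wpow x k @ z) = reduce (wpow x (j + k) @ z)"
  proof (induction j rule: int_induct[where k = 0])
    case (step1 i)
    have "reduce (wpow x (i + 1) @ wpow x k @ z) = reduce (x # wpow x i @ wpow x k @ z)"
      by (simp add: reduce_wpow_step)
    also have "\<dots> = reduce (x # wpow x (i + k) @ z)"
      using step1 by (simp add: reduce_Cons)
    finally show ?case by (simp add: reduce_wpow_step algebra_simps)
  next
    case (step2 i)
    have "reduce (wpow x (i - 1) @ wpow x k @ z) = reduce (linv x # wpow x i @ wpow x k @ z)"
      by (simp add: reduce_wpow_step)
    also have "\<dots> = reduce (linv x # wpow x (i + k) @ z)"
      using step2 by (simp add: reduce_Cons)
    finally show ?case by (simp add: reduce_wpow_step algebra_simps)
  qed simp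
  from reduce_cong[OF this, of p "[]"] show ?thesis by simp
qed

section \<open>Equality of words modulo a normal subgroup\<close>

definition eqv :: "word set \<Rightarrow> word \<Rightarrow> word \<Rightarrow> bool" where
  "eqv N u v \<longleftrightarrow> reduce (u @ winv v) \<in> N"

lemma eqv_Nil: "eqv N w [] \<longleftrightarrow> reduce w \<in> N"
  by (simp add: eqv_def)

context
  fixes N assumes N: "normal_sub N"
begin

lemma eqv_refl: "eqv N u u"
  using N reduce_winv_cancel_right[of "[]" u "[]"] by (simp add: eqv_def normal_sub_def)

lemma eqv_sym: "eqv N u v \<Longrightarrow> eqv N v u"
  using N unfolding eqv_def normal_sub_def
  by (metis reduce_winv winv_append winv_winv)

lemma eqv_trans [trans]: "eqv N u v \<Longrightarrow> eqv N v w \<Longrightarrow> eqv N u w"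
proof -
  assume "eqv N u v" "eqv N v w"
  then have "wmult (reduce (u @ winv v)) (reduce (v @ winv w)) \<in> N"
    using N by (auto simp: eqv_def normal_sub_def)
  then show ?thesis
    by (simp add: wmult_def eqv_def reduce_winv_cancel_left)
qed

lemma eqv_free: "reduce u = reduce v \<Longrightarrow> eqv N u v"
  using eqv_refl[of v] unfolding eqv_def by (metis reduce_reduce_append)

lemma eqv_cong:
  assumes "eqv N u v"
  shows "eqv N (p @ u @ s) (p @ v @ s)"
proof -
  have "wmult (wmult (reduce p) (reduce (u @ winv v))) (winv (reduce p)) \<in> N"
    using N assms by (auto simp: eqv_def normal_sub_def)
  then have "reduce (p @ u @ winv v @ winv p) \<in> N"
    by (simp add: wmult_def flip: reduce_winv)
  then show ?thesis
    using reduce_winv_cancel_right[of "p @ u" s "winv v @ winv p"]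
    by (simp add: eqv_def winv_append)
qed

lemma eqv_Cons: "eqv N u v \<Longrightarrow> eqv N (x # u) (x # v)"
  using eqv_cong[of u v "[x]" "[]"] by simp

end

section \<open>Normal forms in Baumslag-Solitar groups\<close>

definition cres :: "int \<Rightarrow> int \<Rightarrow> int" where
  "cres q k = (k + \<bar>q\<bar> div 2) mod \<bar>q\<bar> - \<bar>q\<bar> div 2"

lemma cres_add_mult [simp]: "cres q (k + q * j) = cres q k"
proof -
  have "q * j = \<bar>q\<bar> * (sgn q * j)"
    by (metis abs_mult_sgn mult.assoc)
  then have "k + q * j + \<bar>q\<bar> div 2 = (k + \<bar>q\<bar> div 2) + \<bar>q\<bar> * (sgn q * j)"
    by simp
  then show ?thesis
    by (simp only: cres_def mod_mult_self2)
qed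

lemma cres_small: "2 * \<bar>k\<bar> < \<bar>q\<bar> \<Longrightarrow> cres q k = k"
  by (simp add: cres_def)

lemma dvd_diff_cres: "q dvd k - cres q k"
proof -
  have "\<bar>q\<bar> dvd (k + \<bar>q\<bar> div 2) - (k + \<bar>q\<bar> div 2) mod \<bar>q\<bar>"
    by (rule dvd_minus_mod)
  moreover have "k - cres q k = (k + \<bar>q\<bar> div 2) - (k + \<bar>q\<bar> div 2) mod \<bar>q\<bar>"
    by (simp add: cres_def)
  ultimately show ?thesis by (simp only: abs_dvd_iff)
qed

lemma cres_decomp: "k = q * ((k - cres q k) div q) + cres q k"
  using dvd_diff_cres[of q k] by simp

lemma cres_cres [simp]: "cres q (cres q k) = cres q k"
  by (metis cres_add_mult cres_decomp add.commute)

lemma cres_mult [simp]: "cres q (q * j) = 0"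
  using cres_add_mult[of q 0 j] by (cases "q = 0") (auto simp: cres_def)

section \<open>The action of words on normal forms\<close>

type_synonym state = "int \<times> (bool \<times> int) list"

text \<open>The state (k, [(e1, c1), (e2, c2), ...]) stands for the normal form
  b^k a^(e1) b^(c1) a^(e2) b^(c2) ... in the HNN extension BS(m, q), where the boolean True
  encodes the exponent -1. The centred residues modulo q have the advantage that the transversal element
  representing a fixed integer does not depend on q once q is large.\<close>

fun valid_list :: "int \<Rightarrow> int \<Rightarrow> (bool \<times> int) list \<Rightarrow> bool" where
  "valid_list m q [] = True"
| "valid_list m q ((e, c) # l) \<longleftrightarrow> (if e then cres q c = c else c mod m = c)
      \<and> (c = 0 \<longrightarrow> (case l of [] \<Rightarrow> True | (e', _) # _ \<Rightarrow> e' = e)) \<and> valid_list m q l"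

abbreviation valid :: "int \<Rightarrow> int \<Rightarrow> state \<Rightarrow> bool" where
  "valid m q s \<equiv> valid_list m q (snd s)"

text \<open>Prepends b^k a^(e) b^c to the normal form \<open>l\<close>. If c = 0 and the opposite
  power of a follows, this is a pinch: it cancels and releases the exponent behind it into the
  leading power of b.\<close>

definition push :: "bool \<Rightarrow> int \<Rightarrow> int \<Rightarrow> (bool \<times> int) list \<Rightarrow> state" where
  "push e c k l = (if c = 0 \<and> l \<noteq> [] \<and> fst (hd l) = (\<not> e) then (k + snd (hd l), tl l) else (k, (e, c) # l))"

text \<open>Left multiplication by a letter. With k = m j + c the relation carries b^(m j) across a
  as b^(q j); for the inverse of a the division is by q, and b^(q j) becomes b^(m j).\<close>

definition act :: "int \<Rightarrow> int \<Rightarrow> letter \<Rightarrow> state \<Rightarrow> state" where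
  "act m q x s = (case x of
      (True, e) \<Rightarrow> (if e then fst s - 1 else fst s + 1, snd s)
    | (False, False) \<Rightarrow> push False (fst s mod m) (q * (fst s div m)) (snd s)
    | (False, True) \<Rightarrow> push True (cres q (fst s)) (m * ((fst s - cres q (fst s)) div q)) (snd s))"

abbreviation acts :: "int \<Rightarrow> int \<Rightarrow> word \<Rightarrow> state \<Rightarrow> state" where
  "acts m q w s \<equiv> foldr (act m q) w s"

lemma valid_push:
  assumes "valid_list m q l" "if e then cres q c = c else c mod m = c"
  shows "valid_list m q (snd (push e c k l))"
  using assms by (cases l) (auto simp: push_def split: list.splits)

lemma valid_act: "valid m q s \<Longrightarrow> valid m q (act m q x s)"
  by (auto simp: act_def valid_push split: prod.splits bool.splits)

text \<open>A letter either creates a head of the list or cancels one. What was created is cancelled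
  by the inverse letter. What was cancelled is recreated identically, because a valid head carries
  its own transversal representative, and it stays, because validity excludes pinches.\<close>

lemma act_act_linv:
  assumes "m \<noteq> 0" "q \<noteq> 0" "valid m q s"
  shows "act m q x (act m q (linv x) s) = s"
proof -
  obtain k l where s: "s = (k, l)" by (cases s)
  obtain g e where x: "x = (g, e)" by (cases x)
  consider "g" | "\<not> g" "e" | "\<not> g" "\<not> e" by blast
  then show ?thesis
  proof cases
    case 1
    then show ?thesis by (auto simp: s x act_def linv_def)
  next
    case 2
    show ?thesis
    proof (cases "k mod m = 0 \<and> l \<noteq> [] \<and> fst (hd l)")
      case True
      then obtain c1 l' where l: "l = (True, c1) # l'"
        by (cases l) auto
      from assms(3) have c1: "cres q c1 = c1" and "c1 = 0 \<Longrightarrow> l' \<noteq> [] \<Longrightarrow> fst (hd l')"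
        by (auto simp: s l split: list.splits)
      moreover have "cres q (q * (k div m) + c1) = c1"
        using cres_add_mult[of q c1 "k div m"] c1 by (simp add: add.commute)
      moreover have "m * (k div m) = k"
        using True by (metis add.right_neutral mult_div_mod_eq)
      ultimately show ?thesis
        using 2 True assms(2) by (auto simp: s x l act_def linv_def push_def)
    next
      case False
      then show ?thesis
        using 2 assms(2) by (auto simp: s x act_def linv_def push_def)
    qed
  next
    case 3
    show ?thesis
    proof (cases "cres q k = 0 \<and> l \<noteq> [] \<and> \<not> fst (hd l)")
      case True
      then obtain c1 l' where l: "l = (False, c1) # l'"
        by (cases l) auto
      from assms(3) have c1: "c1 mod m = c1" and "c1 = 0 \<Longrightarrow> l' \<noteq> [] \<Longrightarrow> \<not> fst (hd l')"
        by (auto simp: s l split: list.splits)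
      moreover have "c1 div m = 0"
        using c1 assms(1) by (metis add_cancel_left_left mult_div_mod_eq mult_eq_0_iff)
      moreover have "q * (k div q) = k"
        using True cres_decomp[of k q] by simp
      ultimately show ?thesis
        using 3 True assms(1) by (auto simp: s x l act_def linv_def push_def)
    next
      case False
      moreover have "q * ((k - cres q k) div q) + cres q k = k"
        using cres_decomp[of k q] by simp
      ultimately show ?thesis
        using 3 assms(1) by (auto simp: s x act_def linv_def push_def)
    qed
  qed
qed

lemma acts_reduce:
  assumes "m \<noteq> 0" "q \<noteq> 0" "valid m q s"
  shows "acts m q (reduce w) s = acts m q w s"
proof (rule foldr_reduce[where P = "valid m q"])
  show "valid m q (act m q x s)" if "valid m q s" for x s
    by (rule valid_act[OF that])
  show "act m q x (act m q (linv x) s) = s" if "valid m q s" for x s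
    by (rule act_act_linv[OF assms(1,2) that])
qed (rule assms)

lemma valid_acts: "valid m q s \<Longrightarrow> valid m q (acts m q w s)"
  by (rule foldr_preserves) (auto intro: valid_act)

lemma acts_wpow_b [simp]: "acts m q (wpow gen_b j) s = (fst s + j, snd s)"
proof -
  have "acts m q (replicate n (True, e)) s = (fst s + (if e then - int n else int n), snd s)" for n e
    by (induction n) (auto simp: act_def)
  then show ?thesis
    by (auto simp: wpow_def gen_b_def linv_def)
qed

lemma acts_winv:
  assumes "m \<noteq> 0" "q \<noteq> 0" "valid m q s"
  shows "acts m q w (acts m q (winv w) s) = s"
  using acts_reduce[OF assms, of "w @ winv w"] reduce_winv_cancel_right[of "[]" w "[]"] by simp

lemma act_relator:
  assumes "m \<noteq> 0" "q \<noteq> 0" "valid m q s"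
  shows "acts m q ([gen_a] @ wpow gen_b m @ [linv gen_a] @ wpow gen_b (- q)) s = s"
proof -
  have *: "act m q gen_a (k + m, l) = (fst (act m q gen_a (k, l)) + q, snd (act m q gen_a (k, l)))" for k l
    using assms(1) by (simp add: act_def gen_a_def push_def distrib_left)
  define s' where "s' = (fst s - q, snd s)"
  have "valid m q s'" using assms by (simp add: s'_def)
  have "act m q gen_a (act m q (linv gen_a) s') = s'"
    by (rule act_act_linv) fact+
  then show ?thesis
    using *[of "fst (act m q (linv gen_a) s')" "snd (act m q (linv gen_a) s')"]
    by (simp add: s'_def)
qed

text \<open>The kernel of the action is a normal subgroup containing the relator, hence contains
  \<open>BS m q\<close>: a word that moves some valid state is nontrivial in the group.\<close>

definition act_kernel :: "int \<Rightarrow> int \<Rightarrow> word set" where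
  "act_kernel m q = {w. reduced w \<and> (\<forall>s. valid m q s \<longrightarrow> acts m q w s = s)}"

lemma normal_sub_act_kernel:
  assumes "m \<noteq> 0" "q \<noteq> 0"
  shows "normal_sub (act_kernel m q)"
proof -
  note red = acts_reduce[OF assms] and inv = acts_winv[OF assms]
  have inv': "acts m q (winv w) s = s" if "w \<in> act_kernel m q" "valid m q s" for w s
    using that inv[of s w] valid_acts[of m q s "winv w"] by (metis (mono_tags, lifting) act_kernel_def mem_Collect_eq)
  have "winv w \<in> act_kernel m q" if "w \<in> act_kernel m q" for w
    using that inv'[OF that] by (simp add: act_kernel_def reduced_winv)
  moreover have "wmult u v \<in> act_kernel m q" if "u \<in> act_kernel m q" "v \<in> act_kernel m q" for u v
    using that by (simp add: act_kernel_def wmult_def red)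
  moreover have "wmult (wmult g n) (winv g) \<in> act_kernel m q" if "n \<in> act_kernel m q" for g n
  proof -
    have "acts m q g (acts m q n (acts m q (winv g) s)) = s" if "valid m q s" for s
      using \<open>n \<in> act_kernel m q\<close> that inv valid_acts[OF that, of "winv g"]
      by (simp add: act_kernel_def del: split_paired_All)
    then show ?thesis
      by (simp add: act_kernel_def wmult_def red del: split_paired_All)
  qed
  ultimately show ?thesis
    by (auto simp: normal_sub_def act_kernel_def[THEN eqset_imp_iff])
qed

lemma normal_sub_normal_closure:
  assumes "R \<subseteq> {w. reduced w}"
  shows "normal_sub (normal_closure R)" "R \<subseteq> normal_closure R"
proof -
  have "normal_sub {w. reduced w}"
    by (auto simp: normal_sub_def wmult_def reduced_winv)
  with assms have "normal_closure R \<subseteq> {w. reduced w}"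
    by (auto simp: normal_closure_def)
  moreover have "\<forall>u\<in>normal_closure R. \<forall>v\<in>normal_closure R. wmult u v \<in> normal_closure R"
    "\<forall>u\<in>normal_closure R. winv u \<in> normal_closure R"
    "\<forall>g. reduced g \<longrightarrow> (\<forall>n\<in>normal_closure R. wmult (wmult g n) (winv g) \<in> normal_closure R)"
    "[] \<in> normal_closure R"
    by (simp_all add: normal_closure_def normal_sub_def)
  ultimately show "normal_sub (normal_closure R)"
    unfolding normal_sub_def by blast
  show "R \<subseteq> normal_closure R"
    by (auto simp: normal_closure_def)
qed

lemma normal_closure_subset: "normal_sub N \<Longrightarrow> R \<subseteq> N \<Longrightarrow> normal_closure R \<subseteq> N"
  by (auto simp: normal_closure_def)

lemma normal_sub_BS: "normal_sub (BS p q)"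
  and bs_relator_in_BS: "bs_relator p q \<in> BS p q"
  using normal_sub_normal_closure[of "{bs_relator p q}"] by (auto simp: BS_def bs_relator_def)

lemma BS_subset_act_kernel:
  assumes "m \<noteq> 0" "q \<noteq> 0"
  shows "BS m q \<subseteq> act_kernel m q"
  unfolding BS_def
proof (rule normal_closure_subset[OF normal_sub_act_kernel[OF assms]])
  have "acts m q (bs_relator m q) s = s" if "valid m q s" for s
    unfolding bs_relator_def by (simp only: acts_reduce[OF assms that] act_relator[OF assms that])
  then show "{bs_relator m q} \<subseteq> act_kernel m q"
    by (simp add: act_kernel_def bs_relator_def)
qed

section \<open>From states back to group elements\<close>

fun list_word :: "(bool \<times> int) list \<Rightarrow> word" where
  "list_word [] = []"
| "list_word ((e, c) # l) = (False, e) # wpow gen_b c @ list_word l"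

definition state_word :: "state \<Rightarrow> word" where
  "state_word s = wpow gen_b (fst s) @ list_word (snd s)"

context
  fixes m q :: int
begin

private abbreviation (input) eqBS :: "word \<Rightarrow> word \<Rightarrow> bool" (infix "\<approx>" 50) where
  "u \<approx> v \<equiv> eqv (BS m q) u v"

lemmas [trans] = eqv_trans[OF normal_sub_BS[of m q]]
lemmas eqBS_free = eqv_free[OF normal_sub_BS[of m q]]
  and eqBS_cong = eqv_cong[OF normal_sub_BS[of m q]]
  and eqBS_sym = eqv_sym[OF normal_sub_BS[of m q]]

lemma BS_relation: "gen_a # wpow gen_b m \<approx> wpow gen_b q @ [gen_a]"
  using bs_relator_in_BS[of m q] by (simp add: eqv_def bs_relator_def winv_append winv_Cons)

lemma BS_relation_pow: "gen_a # wpow gen_b (m * j) \<approx> wpow gen_b (q * j) @ [gen_a]"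
proof (induction j rule: int_induct[where k = 0])
  case base
  then show ?case by (simp add: eqv_refl[OF normal_sub_BS])
next
  case (step1 i)
  have "gen_a # wpow gen_b (m * (i + 1)) \<approx> (gen_a # wpow gen_b (m * i)) @ wpow gen_b m"
    using reduce_wpow_add[of "[gen_a]" gen_b "m * i" m "[]"]
    by (intro eqBS_free) (simp add: algebra_simps)
  also have "\<dots> \<approx> wpow gen_b (q * i) @ (gen_a # wpow gen_b m) @ []"
    using eqBS_cong[OF step1(2), of "[]" "wpow gen_b m"] by simp
  also have "\<dots> \<approx> wpow gen_b (q * i) @ (wpow gen_b q @ [gen_a]) @ []"
    by (rule eqBS_cong[OF BS_relation])
  also have "\<dots> \<approx> wpow gen_b (q * (i + 1)) @ [gen_a]"
    using reduce_wpow_add[of "[]" gen_b "q * i" q "[gen_a]"]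
    by (intro eqBS_free) (simp add: algebra_simps)
  finally show ?case .
next
  case (step2 i)
  have "gen_a # wpow gen_b (m * (i - 1)) \<approx> (gen_a # wpow gen_b (m * i)) @ wpow gen_b (- m)"
    using reduce_wpow_add[of "[gen_a]" gen_b "m * i" "- m" "[]"]
    by (intro eqBS_free) (simp add: algebra_simps)
  also have "\<dots> \<approx> wpow gen_b (q * i) @ gen_a # wpow gen_b (- m)"
    using eqBS_cong[OF step2(2), of "[]" "wpow gen_b (- m)"] by simp
  also have "\<dots> \<approx> wpow gen_b (q * (i - 1)) @ (wpow gen_b q @ [gen_a]) @ wpow gen_b (- m)"
    using reduce_wpow_add[of "[]" gen_b "q * (i - 1)" q "gen_a # wpow gen_b (- m)"]
    by (intro eqBS_free) (simp add: algebra_simps)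
  also have "\<dots> \<approx> wpow gen_b (q * (i - 1)) @ (gen_a # wpow gen_b m) @ wpow gen_b (- m)"
    by (rule eqBS_cong[OF eqBS_sym[OF BS_relation]])
  also have "\<dots> \<approx> wpow gen_b (q * (i - 1)) @ [gen_a]"
    using reduce_wpow_add[of "wpow gen_b (q * (i - 1)) @ [gen_a]" gen_b m "-m" "[]"]
    by (intro eqBS_free) (simp add: algebra_simps)
  finally show ?case .
qed

lemma BS_relation_pow_inv: "linv gen_a # wpow gen_b (q * j) \<approx> wpow gen_b (m * j) @ [linv gen_a]"
proof -
  have "linv gen_a # wpow gen_b (q * j) \<approx> [linv gen_a] @ (wpow gen_b (q * j) @ [gen_a]) @ [linv gen_a]"
    using reduce_winv_cancel_right[of "linv gen_a # wpow gen_b (q * j)" "[gen_a]" "[]"]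
    by (intro eqBS_free) (simp add: winv_Cons)
  also have "\<dots> \<approx> [linv gen_a] @ (gen_a # wpow gen_b (m * j)) @ [linv gen_a]"
    by (rule eqBS_cong[OF eqBS_sym[OF BS_relation_pow]])
  also have "\<dots> \<approx> wpow gen_b (m * j) @ [linv gen_a]"
    by (intro eqBS_free) simp
  finally show ?thesis .
qed

lemma push_word: "wpow gen_b k @ (False, e) # wpow gen_b c @ list_word l \<approx> state_word (push e c k l)"
proof (cases "c = 0 \<and> l \<noteq> [] \<and> fst (hd l) = (\<not> e)")
  case True
  then obtain c1 l' where l: "l = (\<not> e, c1) # l'"
    by (cases l) auto
  have "reduce (wpow gen_b k @ (False, e) # (False, \<not> e) # wpow gen_b c1 @ list_word l')
      = reduce (wpow gen_b k @ wpow gen_b c1 @ list_word l')"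
    using reduce_winv_cancel_right[of "wpow gen_b k" "[(False, e)]" "wpow gen_b c1 @ list_word l'"]
    by (simp add: winv_Cons linv_def)
  with True show ?thesis
    using reduce_wpow_add[of "[]" gen_b k c1 "list_word l'"]
    by (intro eqBS_free) (simp add: l push_def state_word_def)
next
  case False
  then have "push e c k l = (k, (e, c) # l)"
    by (simp only: push_def if_False)
  then show ?thesis
    by (intro eqBS_free) (simp add: state_word_def)
qed

lemma act_word: "x # state_word s \<approx> state_word (act m q x s)"
proof -
  obtain k l where s: "s = (k, l)" by (cases s)
  consider "x = gen_b" | "x = linv gen_b" | "x = gen_a" | "x = linv gen_a"
    by (cases x) (auto simp: gen_a_def gen_b_def linv_def)
  then show ?thesis
  proof cases
    case 1
    then show ?thesis
      using reduce_wpow_step(1)[of gen_b k "list_word l"]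
      by (intro eqBS_free) (simp add: s state_word_def act_def gen_b_def)
  next
    case 2
    then show ?thesis
      using reduce_wpow_step(2)[of gen_b k "list_word l"]
      by (intro eqBS_free) (simp add: s state_word_def act_def gen_b_def linv_def)
  next
    case 3
    define c j where "c = k mod m" and "j = k div m"
    have k: "k = m * j + c" by (simp add: c_def j_def)
    have "gen_a # state_word s \<approx> (gen_a # wpow gen_b (m * j)) @ wpow gen_b c @ list_word l"
      using reduce_wpow_add[of "[gen_a]" gen_b "m * j" c "list_word l"]
      by (intro eqBS_free) (simp add: s state_word_def k)
    also have "\<dots> \<approx> wpow gen_b (q * j) @ (False, False) # wpow gen_b c @ list_word l"
      using eqBS_cong[OF BS_relation_pow[of j], of "[]" "wpow gen_b c @ list_word l"]
      by (simp add: gen_a_def)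
    also have "\<dots> \<approx> state_word (push False c (q * j) l)"
      by (rule push_word)
    finally show ?thesis
      by (simp add: 3 s act_def gen_a_def c_def j_def)
  next
    case 4
    define c j where "c = cres q k" and "j = (k - cres q k) div q"
    have k: "k = q * j + c" using cres_decomp by (simp add: c_def j_def)
    have "linv gen_a # state_word s \<approx> (linv gen_a # wpow gen_b (q * j)) @ wpow gen_b c @ list_word l"
      using reduce_wpow_add[of "[linv gen_a]" gen_b "q * j" c "list_word l"]
      by (intro eqBS_free) (simp add: s state_word_def k)
    also have "\<dots> \<approx> wpow gen_b (m * j) @ (False, True) # wpow gen_b c @ list_word l"
      using eqBS_cong[OF BS_relation_pow_inv[of j], of "[]" "wpow gen_b c @ list_word l"]
      by (simp add: gen_a_def linv_def)
    also have "\<dots> \<approx> state_word (push True c (m * j) l)"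
      by (rule push_word)
    finally show ?thesis
      by (simp add: 4 s act_def gen_a_def linv_def c_def j_def)
  qed
qed

text \<open>Each step of the action only applies the defining relation and free cancellation, so the
  state always represents the element of the word read so far. A word fixing the empty state is
  therefore trivial in BS(m, q).\<close>

lemma acts_word: "w \<approx> state_word (acts m q w (0, []))"
proof (induction w)
  case Nil
  then show ?case by (simp add: state_word_def eqv_refl[OF normal_sub_BS])
next
  case (Cons x w)
  then have "x # w \<approx> x # state_word (acts m q w (0, []))"
    by (rule eqv_Cons[OF normal_sub_BS])
  also have "\<dots> \<approx> state_word (acts m q (x # w) (0, []))"
    using act_word by simp
  finally show ?case .
qed

end

lemma mem_BS_iff:
  assumes "m \<noteq> 0" "q \<noteq> 0"
  shows "reduce w \<in> BS m q \<longleftrightarrow> acts m q w (0, []) = (0, [])"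
proof
  assume "reduce w \<in> BS m q"
  with BS_subset_act_kernel[OF assms] have "acts m q (reduce w) (0, []) = (0, [])"
    by (auto simp: act_kernel_def)
  then show "acts m q w (0, []) = (0, [])"
    using acts_reduce[OF assms] by simp
next
  assume "acts m q w (0, []) = (0, [])"
  then show "reduce w \<in> BS m q"
    using acts_word[of m q w] by (simp add: state_word_def eqv_Nil)
qed

section \<open>Uniformity in the second parameter\<close>

text \<open>Writing t(i) for quot m q i, the word u(0) = a b^m a^(-1) equals b^(q t(0)) in BS(m, q). If
  u(i) equals b^(q t(i)) and r(i) is the remainder of q t(i) modulo m, then
  u(i+1) = a u(i) b^(-r(i)) a^(-1) equals b^(q t(i+1)). For negative m the remainders are nonpositive.\<close>

fun quot :: "int \<Rightarrow> int \<Rightarrow> nat \<Rightarrow> int" where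
  "quot m q 0 = 1"
| "quot m q (Suc i) = (q * quot m q i) div m"

definition digit :: "int \<Rightarrow> int \<Rightarrow> nat \<Rightarrow> int" where
  "digit m q i = (q * quot m q i) mod m"

lemma quot_Suc_decomp: "q * quot m q i = m * quot m q (Suc i) + digit m q i"
  by (simp add: digit_def)

text \<open>Each division by m costs one factor m of precision: q t(i) is known modulo m^(h-i), and
  the remainder subtracted before dividing is the same for both parameters.\<close>

lemma quot_cong:
  assumes "m \<noteq> 0" "m ^ h dvd q - q'" "i \<le> h"
  shows "m ^ (h - i) dvd quot m q i - quot m q' i"
  using assms(3)
proof (induction i)
  case (Suc i)
  define g where "g = h - Suc i"
  have hi: "h - i = Suc g" using Suc.prems by (simp add: g_def)
  have "m ^ Suc g dvd q - q'"
    by (rule dvd_trans[OF le_imp_power_dvd assms(2)]) (use Suc.prems in \<open>simp add: g_def\<close>)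
  moreover have "m ^ Suc g dvd quot m q i - quot m q' i"
    using Suc hi by simp
  ultimately have "m ^ Suc g dvd (q - q') * quot m q i + q' * (quot m q i - quot m q' i)"
    by (intro dvd_add dvd_mult dvd_mult2)
  then have *: "m ^ Suc g dvd q * quot m q i - q' * quot m q' i"
    by (simp add: algebra_simps)
  then have "m dvd q * quot m q i - q' * quot m q' i"
    by (metis dvd_mult_left power_Suc)
  then have "digit m q i = digit m q' i"
    by (simp add: digit_def mod_eq_dvd_iff)
  then have "q * quot m q i - q' * quot m q' i = m * (quot m q (Suc i) - quot m q' (Suc i))"
    unfolding quot_Suc_decomp[of q] quot_Suc_decomp[of q'] by (simp only: algebra_simps)
  with * have "m ^ g dvd quot m q (Suc i) - quot m q' (Suc i)"
    using assms(1) by simp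
  then show ?case by (simp add: g_def)
qed simp

lemma digit_cong:
  assumes "m \<noteq> 0" "m ^ h dvd q - q'" "i < h"
  shows "digit m q i = digit m q' i"
proof -
  have "m ^ h dvd q - q'" "m ^ (h - i) dvd quot m q i - quot m q' i"
    using assms quot_cong by auto
  moreover have "m dvd m ^ h" "m dvd m ^ (h - i)"
    using assms(3) by (auto intro!: dvd_power)
  ultimately have "m dvd q - q'" "m dvd quot m q i - quot m q' i"
    by (meson dvd_trans)+
  then have "m dvd (q - q') * quot m q i + q' * (quot m q i - quot m q' i)"
    by (intro dvd_add dvd_mult dvd_mult2)
  then show ?thesis
    by (simp add: digit_def mod_eq_dvd_iff algebra_simps)
qed

text \<open>If the digits agree, then m^i (t'(i) - t(i)) = (q' - q) G(i) with G(1) = 1 and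
  G(i+1) = q' G(i) + m^i t(i), so that G(i) is prime to m.\<close>

lemma dvd_diff_if_digits_eq:
  assumes "coprime q' m" "\<And>i. i < h \<Longrightarrow> digit m q i = digit m q' i"
  shows "m ^ h dvd q' - q"
proof (cases h)
  case (Suc h')
  \<comment> \<open>The claim starts at exponent 1: at exponent 0 the factor would be 0, and the
    correction term m^i t(i) is a multiple of m only from i = 1 on. Modulo m the next factor is then
    q' G, a product of units.\<close>
  have "\<exists>G. m ^ Suc i * (quot m q' (Suc i) - quot m q (Suc i)) = (q' - q) * G \<and> coprime G m"
    if "i < h" for i
    using that
  proof (induction i)
    case 0
    have "m * (quot m q' (Suc 0) - quot m q (Suc 0)) = q' - q"
      using quot_Suc_decomp[of q' m 0] quot_Suc_decomp[of q m 0] assms(2)[of 0] 0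
      by (simp only: algebra_simps quot.simps(1) mult_1_right)
    then show ?case by (intro exI[of _ 1]) (simp only: power_one_right coprime_1_left mult_1_right One_nat_def[symmetric])
  next
    case (Suc i)
    then obtain G where G: "m ^ Suc i * (quot m q' (Suc i) - quot m q (Suc i)) = (q' - q) * G" "coprime G m"
      by auto
    have "m * (quot m q' (Suc (Suc i)) - quot m q (Suc (Suc i)))
        = q' * quot m q' (Suc i) - q * quot m q (Suc i)"
      using quot_Suc_decomp[of q' m "Suc i"] quot_Suc_decomp[of q m "Suc i"] assms(2)[OF Suc.prems]
      by (simp only: algebra_simps)
    then have "m ^ Suc (Suc i) * (quot m q' (Suc (Suc i)) - quot m q (Suc (Suc i)))
        = m ^ Suc i * (q' * quot m q' (Suc i) - q * quot m q (Suc i))"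
      by (metis mult.assoc power_Suc2)
    also have "\<dots> = q' * (m ^ Suc i * (quot m q' (Suc i) - quot m q (Suc i)))
        + (q' - q) * (m ^ Suc i * quot m q (Suc i))"
      by (simp only: algebra_simps)
    also have "\<dots> = (q' - q) * (q' * G + m * (m ^ i * quot m q (Suc i)))"
      unfolding G(1) by (simp add: algebra_simps del: quot.simps)
    finally have "m ^ Suc (Suc i) * (quot m q' (Suc (Suc i)) - quot m q (Suc (Suc i)))
      = (q' - q) * (q' * G + m * (m ^ i * quot m q (Suc i)))" .
    moreover have "coprime (q' * G + m * (m ^ i * quot m q (Suc i))) m"
    proof -
      have "coprime (q' * G) m" using assms(1) G(2) by simp
      then show ?thesis
        by (metis coprime_commute coprime_iff_gcd_eq_1 gcd_add_mult mult.commute add.commute)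
    qed
    ultimately show ?case by blast
  qed
  from this[of h'] obtain G where "m ^ h dvd (q' - q) * G" "coprime G m"
    unfolding Suc by (metis dvd_triv_left lessI)
  then show ?thesis
    by (metis coprime_commute coprime_dvd_mult_left_iff coprime_power_left_iff)
qed simp

text \<open>Expresses "for all q of large absolute value, of either sign, in the class of x modulo
  |m|^h". A filter hides the thresholds, which depend on the word considered.\<close>

definition class_filter :: "int \<Rightarrow> nat \<Rightarrow> int \<Rightarrow> int filter" where
  "class_filter m h x = inf (filtercomap abs at_top) (principal {q. q mod \<bar>m\<bar> ^ h = x})"

lemma eventually_class_filter_gt: "eventually (\<lambda>q. B < \<bar>q\<bar>) (class_filter m h x)"
  unfolding class_filter_def
  by (rule filter_leD[OF inf_le1]) (auto simp: eventually_filtercomap intro: eventually_gt_at_top)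

lemma eventually_class_filter_residue: "eventually (\<lambda>q. q mod \<bar>m\<bar> ^ h = x) (class_filter m h x)"
  unfolding class_filter_def
  by (rule filter_leD[OF inf_le2]) (auto simp: eventually_principal)

lemma filterlim_class_filter:
  assumes "filterlim (\<lambda>n. \<bar>xi n\<bar>) at_top F" "eventually (\<lambda>n. xi n mod \<bar>m\<bar> ^ h = x) F"
  shows "filterlim xi (class_filter m h x) F"
  using assms unfolding class_filter_def filterlim_inf filterlim_principal
  by (auto simp: filterlim_filtercomap_iff o_def)

lemma eventually_digit_class_filter:
  assumes "m \<noteq> 0"
  shows "\<exists>\<rho>. \<forall>\<^sub>F q in class_filter m h x. \<forall>i<h. digit m q i = \<rho> i"
proof (cases "\<exists>q0. q0 mod \<bar>m\<bar> ^ h = x")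
  case True
  then obtain q0 where q0: "q0 mod \<bar>m\<bar> ^ h = x" by blast
  have "digit m q i = digit m q0 i" if "q mod \<bar>m\<bar> ^ h = x" "i < h" for q i
  proof (rule digit_cong[OF assms _ that(2)])
    have "\<bar>m\<bar> ^ h dvd q - q0"
      using that q0 by (simp flip: mod_eq_dvd_iff)
    then show "m ^ h dvd q - q0"
      by (simp flip: power_abs)
  qed
  then show ?thesis
    by (intro exI[of _ "digit m q0"] eventually_mono[OF eventually_class_filter_residue]) auto
next
  \<comment> \<open>No integer has residue \<open>x\<close>, so the filter is trivial and any digits
    will do.\<close>
  case False
  then show ?thesis
    by (intro exI[of _ "\<lambda>_. 0"] eventually_mono[OF eventually_class_filter_residue]) auto
qed

section \<open>Integer combinations of the iterated quotients\<close>

definition lincomb :: "int list \<Rightarrow> (nat \<Rightarrow> int) \<Rightarrow> int" where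
  "lincomb ns f = (\<Sum>i<length ns. ns ! i * f i)"

lemma lincomb_Nil [simp]: "lincomb [] f = 0"
  by (simp add: lincomb_def)

lemma lincomb_Cons: "lincomb (n # ns) f = n * f 0 + lincomb ns (\<lambda>i. f (Suc i))"
  by (simp add: lincomb_def sum.lessThan_Suc_shift del: sum.lessThan_Suc)

lemma lincomb_mult: "lincomb ns (\<lambda>i. c * f i) = c * lincomb ns f"
  by (simp add: lincomb_def sum_distrib_left mult.left_commute)

text \<open>Division by m shifts the index of t by one and leaves a combination of digits.
  Conversely, \<open>lincomb_quot_Cons\<close> turns q times a shifted combination into an unshifted
  one with a new head coefficient, as t(0) = 1.\<close>

lemma lincomb_quot:
  "lincomb ns (\<lambda>i. q * quot m q i)
     = m * lincomb ns (\<lambda>i. quot m q (Suc i)) + lincomb ns (digit m q)"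
  unfolding quot_Suc_decomp lincomb_def
  by (simp add: sum.distrib sum_distrib_left algebra_simps del: quot.simps)

lemma lincomb_quot_Cons:
  "lincomb (n # ns) (\<lambda>i. q * quot m q i) = q * (n + lincomb ns (\<lambda>i. quot m q (Suc i)))"
  by (simp add: lincomb_mult lincomb_Cons del: quot.simps(2))

lemma lincomb_cong: "(\<And>i. i < length ns \<Longrightarrow> f i = g i) \<Longrightarrow> lincomb ns f = lincomb ns g"
  by (simp add: lincomb_def)

abbreviation num_a :: "word \<Rightarrow> nat" where
  "num_a w \<equiv> count_list w gen_a"

lemma push_lincomb:
  "\<exists>n0' l'. \<forall>k. push e c (n0 + k) l = (n0' + k, l')"
  unfolding push_def by (auto simp: algebra_simps)

text \<open>The letter a divides by m and multiplies by q, which adds a head to \<open>ns\<close>;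
  its inverse divides by q and multiplies by m, which removes the head. So \<open>ns\<close> never
  outgrows the number of letters a, and only the first \<open>h\<close> digits are
  consulted.\<close>

lemma acts_uniform:
  assumes "m \<noteq> 0" "num_a w \<le> h"
  shows "\<exists>n0 ns l. length ns \<le> num_a w \<and> (\<forall>\<^sub>F q in class_filter m h x.
           acts m q w (0, []) = (n0 + lincomb ns (\<lambda>i. q * quot m q i), l))"
  using assms(2)
proof (induction w)
  case Nil
  show ?case by (intro exI[of _ 0] exI[of _ "[]"]) auto
next
  case (Cons y w)
  let ?F = "class_filter m h x"
  let ?E = "\<lambda>q ns. lincomb ns (\<lambda>i. q * quot m q i)"
  from Cons obtain n0 ns l where len: "length ns \<le> num_a w"
    and ev: "\<forall>\<^sub>F q in ?F. acts m q w (0, []) = (n0 + ?E q ns, l)"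
    by (fastforce split: if_splits)
  obtain \<rho> where \<rho>: "\<forall>\<^sub>F q in ?F. \<forall>i<h. digit m q i = \<rho> i"
    using eventually_digit_class_filter[OF assms(1)] by blast
  have R: "\<forall>\<^sub>F q in ?F. lincomb ns' (digit m q) = lincomb ns' \<rho>" if "length ns' \<le> h" for ns'
    using \<rho> by eventually_elim (use that in \<open>auto intro: lincomb_cong\<close>)
  consider "y = gen_b" | "y = linv gen_b" | "y = gen_a" | "y = linv gen_a"
    by (cases y) (auto simp: gen_a_def gen_b_def linv_def)
  then show ?case
  proof cases
    case 1
    have "\<forall>\<^sub>F q in ?F. acts m q (y # w) (0, []) = ((n0 + 1) + ?E q ns, l)"
      using ev by eventually_elim (simp add: 1 act_def gen_b_def)
    with len show ?thesis
      by (intro exI[of _ "n0 + 1"] exI[of _ ns] exI[of _ l]) auto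
  next
    case 2
    have "\<forall>\<^sub>F q in ?F. acts m q (y # w) (0, []) = ((n0 - 1) + ?E q ns, l)"
      using ev by eventually_elim (simp add: 2 act_def gen_b_def linv_def)
    with len show ?thesis
      by (intro exI[of _ "n0 - 1"] exI[of _ ns] exI[of _ l]) auto
  next
    case 3
    \<comment> \<open>\<open>S\<close> is the part of the exponent that remains when the multiple of
      m is split off. It does not involve q; its residue is the entry pushed, its quotient the new
      head coefficient.\<close>
    define S where "S = n0 + lincomb ns \<rho>"
    obtain n0' l' where p: "\<And>k. push False (S mod m) (0 + k) l = (n0' + k, l')"
      using push_lincomb by metis
    have "length ns \<le> h" using Cons.prems len by (auto split: if_splits)
    from R[OF this] ev have "\<forall>\<^sub>F q in ?F. acts m q (y # w) (0, []) = (n0' + ?E q ((S div m) # ns), l')"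
    proof eventually_elim
      case (elim q)
      define T where "T = lincomb ns (\<lambda>i. quot m q (Suc i))"
      have k: "n0 + ?E q ns = S + m * T"
        unfolding lincomb_quot elim(1) S_def T_def by simp
      have "acts m q (y # w) (0, []) = push False ((S + m * T) mod m) (q * ((S + m * T) div m)) l"
        by (simp add: elim(2) k 3 act_def gen_a_def)
      also have "\<dots> = push False (S mod m) (0 + q * (S div m + T)) l"
        using assms(1) by (simp add: add.commute)
      also have "\<dots> = (n0' + q * (S div m + T), l')"
        by (rule p)
      finally show ?case
        by (simp only: lincomb_quot_Cons T_def)
    qed
    with len 3 show ?thesis
      by (intro exI[of _ n0'] exI[of _ "(S div m) # ns"] exI[of _ l']) auto
  next
    case 4
    \<comment> \<open>For large |q| the constant \<open>n0\<close> is its own centred residue; the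
      rest of the exponent is a multiple of q.\<close>
    have big: "\<forall>\<^sub>F q in ?F. 2 * \<bar>n0\<bar> < \<bar>q\<bar>" by (rule eventually_class_filter_gt)
    have step: "act m q (linv gen_a) (n0 + q * Y, l) = push True n0 (m * Y) l" if "2 * \<bar>n0\<bar> < \<bar>q\<bar>" for q Y
    proof -
      have "cres q (n0 + q * Y) = n0" "q \<noteq> 0" using that by (auto simp: cres_small)
      then show ?thesis by (simp add: act_def gen_a_def linv_def)
    qed
    show ?thesis
    proof (cases ns)
      case Nil
      obtain n0' l' where p: "\<And>k. push True n0 (0 + k) l = (n0' + k, l')"
        using push_lincomb by metis
      from big ev have "\<forall>\<^sub>F q in ?F. acts m q (y # w) (0, []) = (n0' + ?E q [], l')"
      proof eventually_elim
        case (elim q)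
        then show ?case using step[of q 0] p[of 0] by (simp add: Nil 4)
      qed
      then show ?thesis
        by (intro exI[of _ n0'] exI[of _ "[]"] exI[of _ l']) auto
    next
      case (Cons n ns')
      obtain n0' l' where p: "\<And>k. push True n0 ((m * n - lincomb ns' \<rho>) + k) l = (n0' + k, l')"
        using push_lincomb by metis
      have "length ns' \<le> h" using Cons.prems len Cons 4 by (auto split: if_splits)
      from R[OF this] big ev have "\<forall>\<^sub>F q in ?F. acts m q (y # w) (0, []) = (n0' + ?E q ns', l')"
      proof eventually_elim
        case (elim q)
        define T where "T = lincomb ns' (\<lambda>i. quot m q (Suc i))"
        have "acts m q (y # w) (0, []) = push True n0 (m * (n + T)) l"
          using step[OF elim(2), of "n + T"]
          by (simp only: foldr.simps o_apply elim(3) Cons 4 lincomb_quot_Cons T_def)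
        \<comment> \<open>Multiplying by m undoes an earlier division, so the remainders reappear
          with a minus sign.\<close>
        also have "m * (n + T) = (m * n - lincomb ns' \<rho>) + ?E q ns'"
          unfolding lincomb_quot elim(1) T_def by (simp add: distrib_left del: quot.simps)
        finally show ?case by (simp only: p)
      qed
      with len Cons 4 show ?thesis
        by (intro exI[of _ n0'] exI[of _ ns'] exI[of _ l']) auto
    qed
  qed
qed

lemma lincomb_zero: "\<forall>n\<in>set ns. n = 0 \<Longrightarrow> lincomb ns f = 0"
  by (auto simp: lincomb_def intro!: sum.neutral)

text \<open>If \<open>n0\<close> is nonzero, the sum is congruent to it modulo q, hence nonzero for
  large |q|. If \<open>n0\<close> is 0, the sum vanishes together with its m/q-fold, which is a
  combination one term shorter with a new constant term.\<close>

lemma lincomb_quot_nonzero: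
  assumes "m \<noteq> 0" "length ns \<le> h"
  shows "(n0 = 0 \<and> (\<forall>n\<in>set ns. n = 0))
    \<or> (\<forall>\<^sub>F q in class_filter m h x. n0 + lincomb ns (\<lambda>i. q * quot m q i) \<noteq> 0)"
  using assms(2)
proof (induction ns arbitrary: n0)
  case Nil
  then show ?case by (cases "n0 = 0") auto
next
  case (Cons n ns)
  let ?F = "class_filter m h x"
  obtain \<rho> where "\<forall>\<^sub>F q in ?F. \<forall>i<h. digit m q i = \<rho> i"
    using eventually_digit_class_filter[OF assms(1)] by blast
  then have R: "\<forall>\<^sub>F q in ?F. lincomb ns (digit m q) = lincomb ns \<rho>"
    by eventually_elim (use Cons.prems in \<open>auto intro: lincomb_cong\<close>)
  have big: "\<forall>\<^sub>F q in ?F. \<bar>n0\<bar> < \<bar>q\<bar>" by (rule eventually_class_filter_gt)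
  show ?case
  proof (cases "n0 = 0")
    case False
    have "\<forall>\<^sub>F q in ?F. n0 + lincomb (n # ns) (\<lambda>i. q * quot m q i) \<noteq> 0"
      using big
    proof eventually_elim
      case (elim q)
      have "\<not> q dvd n0" using elim False by (metis abs_dvd_iff dvd_abs_iff not_le zdvd_imp_le zero_less_abs_iff)
      then show ?case
        unfolding lincomb_quot_Cons by (metis add_eq_0_iff dvd_minus_iff dvd_triv_left)
    qed
    then show ?thesis ..
  next
    case True
    have *: "m * (n + lincomb ns (\<lambda>i. quot m q (Suc i)))
        = (m * n - lincomb ns (digit m q)) + lincomb ns (\<lambda>i. q * quot m q i)" for q
      unfolding lincomb_quot by (simp add: distrib_left del: quot.simps)
    have "length ns \<le> h" using Cons.prems by simp
    from Cons.IH[OF this, of "m * n - lincomb ns \<rho>"] show ?thesis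
    proof (elim disjE)
      assume "m * n - lincomb ns \<rho> = 0 \<and> (\<forall>n\<in>set ns. n = 0)"
      then show ?thesis
        using assms(1) True by (auto simp: lincomb_zero)
    next
      assume "\<forall>\<^sub>F q in ?F. (m * n - lincomb ns \<rho>) + lincomb ns (\<lambda>i. q * quot m q i) \<noteq> 0"
      with R big have "\<forall>\<^sub>F q in ?F. n0 + lincomb (n # ns) (\<lambda>i. q * quot m q i) \<noteq> 0"
      proof eventually_elim
        case (elim q)
        then have "m * (n + lincomb ns (\<lambda>i. quot m q (Suc i))) \<noteq> 0"
          by (simp only: * not_False_eq_True)
        with elim(2) show ?case
          unfolding lincomb_quot_Cons True by auto
      qed
      then show ?thesis ..
    qed
  qed
qed

text \<open>The source of convergence: as |q| grows within a residue class modulo |m|^h, membership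
  of a word with at most \<open>h\<close> letters a cannot keep oscillating.\<close>

lemma mem_BS_dichotomy:
  assumes "m \<noteq> 0" "num_a w \<le> h"
  shows "(\<forall>\<^sub>F q in class_filter m h x. reduce w \<in> BS m q) \<or> (\<forall>\<^sub>F q in class_filter m h x. reduce w \<notin> BS m q)"
proof -
  let ?F = "class_filter m h x"
  obtain n0 ns l where len: "length ns \<le> num_a w"
    and ev: "\<forall>\<^sub>F q in ?F. acts m q w (0, []) = (n0 + lincomb ns (\<lambda>i. q * quot m q i), l)"
    using acts_uniform[OF assms] by blast
  have "\<forall>\<^sub>F q in ?F. 0 < \<bar>q\<bar>" by (rule eventually_class_filter_gt)
  with ev have ev: "\<forall>\<^sub>F q in ?F. reduce w \<in> BS m q \<longleftrightarrow> n0 + lincomb ns (\<lambda>i. q * quot m q i) = 0 \<and> l = []"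
    by eventually_elim (use assms(1) in \<open>auto simp: mem_BS_iff\<close>)
  have "length ns \<le> h" using len assms(2) by simp
  from lincomb_quot_nonzero[OF assms(1) this, of n0 x]
  consider "n0 = 0" "\<forall>n\<in>set ns. n = 0" "l = []" | "l \<noteq> []"
    | "\<forall>\<^sub>F q in ?F. n0 + lincomb ns (\<lambda>i. q * quot m q i) \<noteq> 0"
    by blast
  then show ?thesis
  proof cases
    case 1
    from ev have "\<forall>\<^sub>F q in ?F. reduce w \<in> BS m q"
      by eventually_elim (use 1 in \<open>simp add: lincomb_zero\<close>)
    then show ?thesis ..
  next
    case 2
    from ev have "\<forall>\<^sub>F q in ?F. reduce w \<notin> BS m q"
      by eventually_elim (use 2 in simp)
    then show ?thesis ..
  next
    case 3
    with ev have "\<forall>\<^sub>F q in ?F. reduce w \<notin> BS m q"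
      by eventually_elim simp
    then show ?thesis ..
  qed
qed

section \<open>The limit groups\<close>

definition a_exp :: "letter \<Rightarrow> int" where
  "a_exp x = (if x = gen_a then 1 else if x = linv gen_a then -1 else 0)"

definition a_sum :: "word \<Rightarrow> int" where
  "a_sum w = sum_list (map a_exp w)"

lemma a_exp_linv [simp]: "a_exp (linv x) = - a_exp x"
  by (auto simp: a_exp_def gen_a_def linv_def prod_eq_iff)

lemma a_sum_Nil [simp]: "a_sum [] = 0"
  and a_sum_Cons: "a_sum (x # w) = a_exp x + a_sum w"
  and a_sum_append: "a_sum (u @ v) = a_sum u + a_sum v"
  by (simp_all add: a_sum_def)

lemma a_sum_reduce [simp]: "a_sum (reduce w) = a_sum w"
proof (induction w)
  case (Cons x w)
  then show ?case
    by (auto simp: reduce_Cons rcons_def a_sum_def split: list.splits)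
qed simp

lemma a_sum_winv [simp]: "a_sum (winv w) = - a_sum w"
  by (induction w) (auto simp: winv_Cons a_sum_def)

lemma a_sum_wpow_b [simp]: "a_sum (wpow gen_b k) = 0"
  by (auto simp: a_sum_def wpow_def sum_list_replicate a_exp_def gen_a_def gen_b_def linv_def)

lemma a_sum_BS: "w \<in> BS m q \<Longrightarrow> a_sum w = 0"
proof -
  have "normal_sub {w. reduced w \<and> a_sum w = 0}"
    by (auto simp: normal_sub_def wmult_def a_sum_append reduced_winv)
  moreover have "a_sum (bs_relator m q) = 0"
    unfolding bs_relator_def by (simp add: a_sum_append a_sum_Cons)
  ultimately have "BS m q \<subseteq> {w. reduced w \<and> a_sum w = 0}"
    unfolding BS_def by (intro normal_closure_subset) (auto simp: bs_relator_def)
  then show "w \<in> BS m q \<Longrightarrow> a_sum w = 0" by blast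
qed

text \<open>In \<open>2 * num_a w \<le> length w + a_sum w\<close> a letter a contributes 2 to both
  sides, its inverse 0 to both, and b and its inverse only to the right.\<close>

lemma num_a_le: "a_sum w = 0 \<Longrightarrow> 2 * num_a w \<le> length w"
proof -
  have "2 * int (num_a w) \<le> int (length w) + a_sum w" for w
    by (induction w) (auto simp: a_sum_def a_exp_def)
  from this[of w] show "a_sum w = 0 \<Longrightarrow> 2 * num_a w \<le> length w" by simp
qed

lemma madic_range: "x \<in> madic m \<Longrightarrow> 0 \<le> x k \<and> x k < \<bar>m\<bar> ^ k"
  by (simp add: madic_def)

lemma madic_mod:
  assumes "x \<in> madic m" "h \<le> h'"
  shows "x h' mod \<bar>m\<bar> ^ h = x h"
  using assms(2)
proof (induction h' rule: dec_induct)
  case base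
  then show ?case using madic_range[OF assms(1)] by simp
next
  case (step n)
  have "x (Suc n) mod \<bar>m\<bar> ^ h = x (Suc n) mod \<bar>m\<bar> ^ n mod \<bar>m\<bar> ^ h"
    using step by (simp add: mod_mod_cancel le_imp_power_dvd)
  also have "x (Suc n) mod \<bar>m\<bar> ^ n = x n"
    using assms(1) by (simp add: madic_def)
  finally show ?case using step by simp
qed

text \<open>Nontriviality lets a statement free of q be read off once it holds eventually.\<close>

lemma class_filter_neq_bot:
  assumes "x \<in> madic m" "m \<noteq> 0"
  shows "class_filter m h (x h) \<noteq> bot"
proof -
  have "filterlim (\<lambda>n. \<bar>x h + \<bar>m\<bar> ^ h * int n\<bar>) at_top sequentially"
  proof (rule filterlim_at_top_mono[OF filterlim_int_sequentially], rule always_eventually, rule allI)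
    fix n
    have "1 * int n \<le> \<bar>m\<bar> ^ h * int n"
      using assms(2) by (intro mult_right_mono) (auto simp: Suc_le_eq one_le_power)
    then show "int n \<le> \<bar>x h + \<bar>m\<bar> ^ h * int n\<bar>"
      using madic_range[OF assms(1), of h] by linarith
  qed
  then have "filterlim (\<lambda>n. x h + \<bar>m\<bar> ^ h * int n) (class_filter m h (x h)) sequentially"
    using madic_range[OF assms(1), of h] by (intro filterlim_class_filter) auto
  then show ?thesis
    by (auto simp: filterlim_def filtermap_bot_iff bot_unique)
qed

lemma class_filter_mono:
  assumes "x \<in> madic m" "h \<le> h'"
  shows "class_filter m h' (x h') \<le> class_filter m h (x h)"
  unfolding class_filter_def
proof (intro inf_mono order_refl)
  have "q mod \<bar>m\<bar> ^ h = x h" if "q mod \<bar>m\<bar> ^ h' = x h'" for q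
    using madic_mod[OF assms] that mod_mod_cancel[OF le_imp_power_dvd[OF assms(2)], of q "\<bar>m\<bar>"] by metis
  then show "principal {q. q mod \<bar>m\<bar> ^ h' = x h'} \<le> principal {q. q mod \<bar>m\<bar> ^ h = x h}"
    by auto
qed

text \<open>An explicit form of the limit, in contrast to the definite description
  \<open>barBS\<close>. The level \<open>h\<close> is existential, but any level from the number of
  letters a on decides membership.\<close>

definition bs_limit :: "int \<Rightarrow> (nat \<Rightarrow> int) \<Rightarrow> word set" where
  "bs_limit m x = {w. reduced w \<and> (\<exists>h. \<forall>\<^sub>F q in class_filter m h (x h). w \<in> BS m q)}"

text \<open>The filters shrink as the level grows, so opposite statements at two levels would meet
  at the larger one, whose filter is nontrivial.\<close>

lemma not_mem_bs_limit:
  assumes "x \<in> madic m" "m \<noteq> 0" "\<forall>\<^sub>F q in class_filter m h (x h). w \<notin> BS m q"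
  shows "w \<notin> bs_limit m x"
proof
  assume "w \<in> bs_limit m x"
  then obtain h' where h': "\<forall>\<^sub>F q in class_filter m h' (x h'). w \<in> BS m q"
    by (auto simp: bs_limit_def)
  have "\<forall>\<^sub>F q in class_filter m (max h h') (x (max h h')). False"
    using filter_leD[OF class_filter_mono[OF assms(1) max.cobounded2] h']
      filter_leD[OF class_filter_mono[OF assms(1) max.cobounded1] assms(3)]
    by eventually_elim auto
  then show False
    using class_filter_neq_bot[OF assms(1,2)] by (simp add: eventually_False)
qed

lemma eventually_mem_BS_iff:
  assumes "x \<in> madic m" "m \<noteq> 0" "reduced w" "num_a w \<le> h"
  shows "\<forall>\<^sub>F q in class_filter m h (x h). w \<in> BS m q \<longleftrightarrow> w \<in> bs_limit m x"
  using mem_BS_dichotomy[OF assms(2,4), of "x h"]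
proof (elim disjE)
  assume *: "\<forall>\<^sub>F q in class_filter m h (x h). reduce w \<in> BS m q"
  then have "w \<in> bs_limit m x"
    using assms(3) by (auto simp: bs_limit_def reduce_of_reduced)
  with * show ?thesis using assms(3) by (simp add: reduce_of_reduced)
next
  assume *: "\<forall>\<^sub>F q in class_filter m h (x h). reduce w \<notin> BS m q"
  then have "w \<notin> bs_limit m x"
    using assms by (intro not_mem_bs_limit[of x m _ h]) (auto simp: reduce_of_reduced)
  with * show ?thesis using assms(3) by (simp add: reduce_of_reduced)
qed

section \<open>The metric and pointwise convergence\<close>

lemma mg_dist_le:
  assumes "\<And>w. length w < k \<Longrightarrow> w \<in> N1 \<longleftrightarrow> w \<in> N2"
  shows "mg_dist N1 N2 \<le> exp (- real k)"
proof (cases "N1 = N2")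
  case False
  let ?P = "\<lambda>k. \<exists>w. w \<in> (N1 - N2) \<union> (N2 - N1) \<and> length w = k"
  have "\<exists>k. ?P k" using False by blast
  then have "?P (LEAST k. ?P k)" by (rule LeastI_ex)
  then obtain w where "w \<in> (N1 - N2) \<union> (N2 - N1)" "length w = (LEAST k. ?P k)" by blast
  then have "k \<le> (LEAST k. ?P k)"
    using assms[of w] by (cases "length w < k") auto
  with False show ?thesis by (simp add: mg_dist_def)
qed (simp add: mg_dist_def)

lemma mg_dist_ge:
  assumes "(w \<in> N1) \<noteq> (w \<in> N2)"
  shows "exp (- real (length w)) \<le> mg_dist N1 N2"
proof -
  have "(LEAST k. \<exists>w. w \<in> (N1 - N2) \<union> (N2 - N1) \<and> length w = k) \<le> length w"
    using assms by (intro Least_le) blast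
  with assms show ?thesis by (auto simp: mg_dist_def)
qed

lemma mg_dist_nonneg: "0 \<le> mg_dist N1 N2"
  and mg_dist_le_1: "mg_dist N1 N2 \<le> 1"
  by (auto simp: mg_dist_def)

lemma normal_sub_reduced: "normal_sub N \<Longrightarrow> w \<in> N \<Longrightarrow> reduced w"
  by (auto simp: normal_sub_def)

text \<open>Every instance of a closure condition involves finitely many words, so it passes to a
  pointwise limit.\<close>

lemma normal_sub_pointwise_limit:
  assumes norm: "\<And>n. normal_sub (Ns n)" and sub: "N \<subseteq> {w. reduced w}"
    and lim: "\<And>w. reduced w \<Longrightarrow> \<forall>\<^sub>F n in sequentially. w \<in> Ns n \<longleftrightarrow> w \<in> N"
  shows "normal_sub N"
proof -
  have memI: "w \<in> N" if "reduced w" "\<forall>\<^sub>F n in sequentially. w \<in> Ns n" for w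
  proof -
    from that(2) lim[OF that(1)] have "\<forall>\<^sub>F n in sequentially. w \<in> N"
      by eventually_elim simp
    then show ?thesis by simp
  qed
  have memD: "\<forall>\<^sub>F n in sequentially. w \<in> Ns n" if "w \<in> N" for w
    using lim[of w] sub that by auto
  have "[] \<in> N"
    using norm by (intro memI) (auto simp: normal_sub_def)
  moreover have "wmult u v \<in> N" if "u \<in> N" "v \<in> N" for u v
  proof (rule memI)
    show "reduced (wmult u v)" by (simp add: wmult_def)
    show "\<forall>\<^sub>F n in sequentially. wmult u v \<in> Ns n"
      using memD[OF that(1)] memD[OF that(2)]
      by eventually_elim (use norm in \<open>simp add: normal_sub_def\<close>)
  qed
  moreover have "winv u \<in> N" if "u \<in> N" for u
  proof (rule memI)
    show "reduced (winv u)"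
      using sub that by (auto intro: reduced_winv)
    show "\<forall>\<^sub>F n in sequentially. winv u \<in> Ns n"
      using memD[OF that] by eventually_elim (use norm in \<open>simp add: normal_sub_def\<close>)
  qed
  moreover have "wmult (wmult g n) (winv g) \<in> N" if "reduced g" "n \<in> N" for g n
  proof (rule memI)
    show "reduced (wmult (wmult g n) (winv g))" by (simp add: wmult_def)
    show "\<forall>\<^sub>F k in sequentially. wmult (wmult g n) (winv g) \<in> Ns k"
      using memD[OF that(2)] by eventually_elim (use norm that(1) in \<open>simp add: normal_sub_def\<close>)
  qed
  ultimately show ?thesis
    using sub by (simp add: normal_sub_def)
qed

lemma tendsto_mg_dist_iff:
  assumes norm: "\<And>n. normal_sub (Ns n)" "normal_sub N"
  shows "(\<lambda>n. mg_dist (Ns n) N) \<longlonglongrightarrow> 0 \<longleftrightarrow>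
    (\<forall>w. reduced w \<longrightarrow> (\<forall>\<^sub>F n in sequentially. w \<in> Ns n \<longleftrightarrow> w \<in> N))"
proof (intro iffI allI impI)
  fix w :: word
  assume "(\<lambda>n. mg_dist (Ns n) N) \<longlonglongrightarrow> 0"
  then have "\<forall>\<^sub>F n in sequentially. mg_dist (Ns n) N < exp (- real (length w))"
    by (rule order_tendstoD) simp
  then show "\<forall>\<^sub>F n in sequentially. w \<in> Ns n \<longleftrightarrow> w \<in> N"
  proof eventually_elim
    case (elim n)
    then show ?case using mg_dist_ge[of w "Ns n" N] by linarith
  qed
next
  assume lim: "\<forall>w. reduced w \<longrightarrow> (\<forall>\<^sub>F n in sequentially. w \<in> Ns n \<longleftrightarrow> w \<in> N)"
  have lim': "\<forall>\<^sub>F n in sequentially. w \<in> Ns n \<longleftrightarrow> w \<in> N" for w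
    using lim normal_sub_reduced[OF norm(1)] normal_sub_reduced[OF norm(2)]
    by (cases "reduced w") (auto intro!: always_eventually)
  have le: "\<forall>\<^sub>F n in sequentially. mg_dist (Ns n) N \<le> exp (- real k)" for k
  proof -
    \<comment> \<open>With two generators there are finitely many words of bounded length, so
      pointwise convergence is uniform on balls.\<close>
    have "finite {w :: word. length w \<le> k}"
      using finite_lists_length_le[of "UNIV :: letter set" k] by simp
    then have "\<forall>\<^sub>F n in sequentially. \<forall>w\<in>{w. length w \<le> k}. w \<in> Ns n \<longleftrightarrow> w \<in> N"
      using lim' by (intro eventually_ball_finite) auto
    then show ?thesis
      by eventually_elim (auto intro!: mg_dist_le)
  qed
  show "(\<lambda>n. mg_dist (Ns n) N) \<longlonglongrightarrow> 0"
  proof (rule tendstoI)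
    fix e :: real assume "e > 0"
    obtain k where "- ln e < real k" using reals_Archimedean2 by blast
    then have "exp (- real k) < e"
      using \<open>e > 0\<close> by (metis exp_less_mono exp_ln minus_less_iff)
    with le[of k] show "\<forall>\<^sub>F n in sequentially. dist (mg_dist (Ns n) N) 0 < e"
      by (auto simp: mg_dist_nonneg elim!: eventually_mono)
  qed
qed

lemma eventually_mem_BS_seq:
  assumes "x \<in> madic m" "m \<noteq> 0" "reduced w"
    and "filterlim (\<lambda>n. \<bar>xi n\<bar>) at_top sequentially" "madic_tendsto m xi x"
  shows "\<forall>\<^sub>F n in sequentially. w \<in> BS m (xi n) \<longleftrightarrow> w \<in> bs_limit m x"
proof -
  have "filterlim xi (class_filter m (num_a w) (x (num_a w))) sequentially"
    using assms(4,5) by (intro filterlim_class_filter) (auto simp: madic_tendsto_def)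
  from filterlim_iff[THEN iffD1, OF this, rule_format, OF eventually_mem_BS_iff[OF assms(1-3) order_refl]]
  show ?thesis .
qed

lemma barBS_eq_bs_limit:
  assumes "x \<in> madic m" "\<bar>m\<bar> \<ge> 2"
  shows "barBS m x = bs_limit m x"
proof -
  have m: "m \<noteq> 0" using assms(2) by auto
  \<comment> \<open>Uniqueness in \<open>barBS\<close> requires at least one admissible sequence.
    Adding |m|^n forces divergence and keeps the residues modulo |m|^k for k \<le> n.\<close>
  define xi where "xi = (\<lambda>n. x n + \<bar>m\<bar> ^ n)"
  have xi_lim: "filterlim (\<lambda>n. \<bar>xi n\<bar>) at_top sequentially"
  proof (rule filterlim_at_top_mono[OF filterlim_int_sequentially], rule always_eventually, rule allI)
    fix n
    have "int n < 2 ^ n" by (metis of_nat_less_two_power)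
    also have "2 ^ n \<le> \<bar>m\<bar> ^ n" using assms(2) by (intro power_mono) auto
    finally show "int n \<le> \<bar>xi n\<bar>"
      using madic_range[OF assms(1), of n] by (simp add: xi_def)
  qed
  have xi_tendsto: "madic_tendsto m xi x"
    unfolding madic_tendsto_def
  proof
    fix k
    have "xi n mod \<bar>m\<bar> ^ k = x k" if "k \<le> n" for n
      using madic_mod[OF assms(1) that] le_imp_power_dvd[OF that, of "\<bar>m\<bar>"]
      by (auto simp: xi_def elim!: dvdE)
    then show "\<forall>\<^sub>F n in sequentially. xi n mod \<bar>m\<bar> ^ k = x k"
      by (auto simp: eventually_sequentially)
  qed
  have norm: "normal_sub (bs_limit m x)"
  proof (rule normal_sub_pointwise_limit)
    show "normal_sub (BS m (xi n))" for n by (rule normal_sub_BS)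
    show "bs_limit m x \<subseteq> {w. reduced w}" by (auto simp: bs_limit_def)
    show "\<forall>\<^sub>F n in sequentially. w \<in> BS m (xi n) \<longleftrightarrow> w \<in> bs_limit m x" if "reduced w" for w
      by (rule eventually_mem_BS_seq[OF assms(1) m that xi_lim xi_tendsto])
  qed
  show ?thesis
    unfolding barBS_def
  proof (rule the_equality)
    show "\<forall>xi. filterlim (\<lambda>n. \<bar>xi n\<bar>) at_top sequentially \<and> madic_tendsto m xi x
        \<longrightarrow> mg_tendsto (\<lambda>n. BS m (xi n)) (bs_limit m x)"
      unfolding mg_tendsto_def marked_groups_def tendsto_mg_dist_iff[OF normal_sub_BS norm]
      using norm eventually_mem_BS_seq[OF assms(1) m] by blast
  next
    fix N
    assume "\<forall>xi. filterlim (\<lambda>n. \<bar>xi n\<bar>) at_top sequentially \<and> madic_tendsto m xi x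
        \<longrightarrow> mg_tendsto (\<lambda>n. BS m (xi n)) N"
    then have "mg_tendsto (\<lambda>n. BS m (xi n)) N"
      using xi_lim xi_tendsto by blast
    then have N: "normal_sub N" and "(\<lambda>n. mg_dist (BS m (xi n)) N) \<longlonglongrightarrow> 0"
      by (simp_all add: mg_tendsto_def marked_groups_def)
    then have N_lim: "\<forall>\<^sub>F n in sequentially. w \<in> BS m (xi n) \<longleftrightarrow> w \<in> N" if "reduced w" for w
      using that unfolding tendsto_mg_dist_iff[OF normal_sub_BS N] by blast
    show "N = bs_limit m x"
    proof (rule set_eqI)
      fix w
      show "w \<in> N \<longleftrightarrow> w \<in> bs_limit m x"
      proof (cases "reduced w")
        case True
        have "\<forall>\<^sub>F n in sequentially. w \<in> N \<longleftrightarrow> w \<in> bs_limit m x"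
          using N_lim[OF True] eventually_mem_BS_seq[OF assms(1) m True xi_lim xi_tendsto]
          by eventually_elim simp
        then show ?thesis by simp
      next
        case False
        then show ?thesis using normal_sub_reduced N norm by blast
      qed
    qed
  qed
qed

lemma mg_dist_bs_limit_le:
  assumes "x \<in> madic m" "y \<in> madic m" "m \<noteq> 0" "x h = y h"
  shows "mg_dist (bs_limit m x) (bs_limit m y) \<le> exp (- 2 * real h)"
proof -
  have sub: "w \<in> bs_limit m y"
    if xy: "x \<in> madic m" "y \<in> madic m" "x h = y h" and w: "length w < 2 * h" "w \<in> bs_limit m x" for x y w
  proof -
    have red: "reduced w" and "\<exists>h. \<forall>\<^sub>F q in class_filter m h (x h). w \<in> BS m q"
      using w by (auto simp: bs_limit_def)
    then obtain h' where "\<forall>\<^sub>F q in class_filter m h' (x h'). w \<in> BS m q" by blast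
    \<comment> \<open>Triviality in a single BS(m, q) already forces exponent sum 0; with length
      below 2 h this leaves at most \<open>h\<close> letters a.\<close>
    then have "\<exists>q. w \<in> BS m q"
      using class_filter_neq_bot[OF xy(1) assms(3)] eventually_happens by blast
    then have "num_a w \<le> h"
      using num_a_le[OF a_sum_BS] w(1) by fastforce
    note iff = eventually_mem_BS_iff[OF _ assms(3) red this]
    have "\<forall>\<^sub>F q in class_filter m h (x h). w \<in> bs_limit m y"
      using iff[OF xy(1)] iff[OF xy(2)] unfolding xy(3) by eventually_elim (use w(2) in simp)
    then show ?thesis
      using class_filter_neq_bot[OF xy(1) assms(3)] by (auto dest: eventually_happens)
  qed
  have "mg_dist (bs_limit m x) (bs_limit m y) \<le> exp (- real (2 * h))"
    using sub[OF assms(1,2,4)] sub[OF assms(2,1) assms(4)[symmetric]] by (intro mg_dist_le) blast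
  then show ?thesis by simp
qed

section \<open>Words separating limit groups\<close>

text \<open>The words u(i) of the iterated quotients, with prescribed remainders in place of the
  digits of q, so that one word can be tested against several parameters.\<close>

fun tower :: "int \<Rightarrow> (nat \<Rightarrow> int) \<Rightarrow> nat \<Rightarrow> word" where
  "tower m \<rho> 0 = [gen_a] @ wpow gen_b m @ [linv gen_a]"
| "tower m \<rho> (Suc i) = [gen_a] @ tower m \<rho> i @ wpow gen_b (- \<rho> i) @ [linv gen_a]"

text \<open>The exponent of u(i) as a power of b varies with q, but commuting with b is a single
  relation independent of q.\<close>

definition comm_b :: "word \<Rightarrow> word" where
  "comm_b u = u @ [gen_b] @ winv u @ [linv gen_b]"

text \<open>Each level costs a letter a, its inverse and at most |m| - 1 letters b: this is the |m|
  + 1 of the lower bound.\<close>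

lemma length_tower:
  assumes "\<And>i. \<bar>\<rho> i\<bar> < \<bar>m\<bar>"
  shows "int (length (tower m \<rho> i)) \<le> (\<bar>m\<bar> + 1) * int i + \<bar>m\<bar> + 2"
proof (induction i)
  case (Suc i)
  then show ?case using assms[of i] by (simp add: algebra_simps)
qed simp

lemma act_b [simp]: "act m q gen_b s = (fst s + 1, snd s)" "act m q (linv gen_b) s = (fst s - 1, snd s)"
  by (simp_all add: act_def gen_b_def linv_def)

lemma act_a_add_mult:
  "m \<noteq> 0 \<Longrightarrow> act m q gen_a (k + m * j, l) = (fst (act m q gen_a (k, l)) + q * j, snd (act m q gen_a (k, l)))"
  by (simp add: act_def gen_a_def push_def distrib_left)

lemma acts_tower:
  assumes "m \<noteq> 0" "q \<noteq> 0" "\<And>j. j < i \<Longrightarrow> \<rho> j = digit m q j" "valid m q s"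
  shows "acts m q (tower m \<rho> i) s = (fst s + q * quot m q i, snd s)"
  using assms(3,4)
proof (induction i arbitrary: s)
  case 0
  define s' where "s' = act m q (linv gen_a) s"
  have "act m q gen_a s' = s" unfolding s'_def by (rule act_act_linv) (use assms 0 in auto)
  then show ?case
    using act_a_add_mult[OF assms(1), of q "fst s'" 1 "snd s'"]
    by (simp add: s'_def[symmetric])
next
  case (Suc i)
  define s' where "s' = act m q (linv gen_a) s"
  have s': "act m q gen_a s' = s" unfolding s'_def by (rule act_act_linv) (use assms Suc in auto)
  have "valid m q (fst s' - \<rho> i, snd s')"
    using Suc.prems valid_act[of m q s] by (simp add: s'_def)
  from Suc.IH[OF Suc.prems(1) this]
  have "acts m q (tower m \<rho> i) (fst s' - \<rho> i, snd s') = (fst s' + m * quot m q (Suc i), snd s')"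
    using quot_Suc_decomp[of q m i] Suc.prems(1)[of i] by (simp del: quot.simps)
  then have "acts m q (tower m \<rho> (Suc i)) s = act m q gen_a (fst s' + m * quot m q (Suc i), snd s')"
    by (simp add: s'_def[symmetric] del: quot.simps)
  then show ?case
    using act_a_add_mult[OF assms(1)] s' by (simp del: quot.simps)
qed

lemma acts_winv_shift:
  assumes "m \<noteq> 0" "q \<noteq> 0" "\<And>s. valid m q s \<Longrightarrow> acts m q u s = (fst s + k, snd s)" "valid m q s"
  shows "acts m q (winv u) s = (fst s - k, snd s)"
proof -
  have "acts m q u (acts m q (winv u) s) = s"
    by (rule acts_winv[OF assms(1,2,4)])
  then have "(fst (acts m q (winv u) s) + k, snd (acts m q (winv u) s)) = s"
    using assms(3)[OF valid_acts[OF assms(4)]] by simp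
  then show ?thesis by (metis add_diff_cancel_right' fst_conv snd_conv prod.collapse)
qed

lemma comm_tower_in_BS:
  assumes "m \<noteq> 0" "q \<noteq> 0" "\<And>j. j < i \<Longrightarrow> \<rho> j = digit m q j"
  shows "reduce (comm_b (tower m \<rho> i)) \<in> BS m q"
proof -
  note t = acts_tower[OF assms(1,2), of i \<rho>, OF assms(3)]
  have "acts m q (winv (tower m \<rho> i)) (-1, []) = (-1 - q * quot m q i, [])"
    using acts_winv_shift[OF assms(1,2) t, where s = "(-1, [])"] by simp
  then show ?thesis
    using t[of "(- (q * quot m q i), [])"]
    by (simp add: mem_BS_iff[OF assms(1,2)] comm_b_def)
qed

text \<open>A wrong remainder makes the tower act as a b^k a^(-1) with k not divisible by m. Its
  commutator with b then has no pinch, neither at b^k and b^(-k) nor at the b between the two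
  factors. The condition |q| > 2 makes 1 and -1 their own centred residues.\<close>

lemma comm_tower_not_in_BS:
  assumes "m \<noteq> 0" "\<bar>q\<bar> > 2" "\<And>j. j < i \<Longrightarrow> \<rho> j = digit m q j"
    "\<rho> i mod m \<noteq> digit m q i"
  shows "reduce (comm_b (tower m \<rho> (Suc i))) \<notin> BS m q"
proof -
  have q: "q \<noteq> 0" using assms(2) by auto
  define k where "k = q * quot m q i - \<rho> i"
  have k: "\<not> m dvd k"
    using assms(4) unfolding k_def digit_def mod_eq_dvd_iff by (metis mod_eq_dvd_iff mod_mod_trivial)
  define sh :: "int \<Rightarrow> state \<Rightarrow> state" where "sh = (\<lambda>k s. (fst s + k, snd s))"
  note t = acts_tower[OF assms(1) q, of i \<rho>, OF assms(3)]
  have u: "acts m q (tower m \<rho> (Suc i)) s = act m q gen_a (sh k (act m q (linv gen_a) s))"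
    if "valid m q s" for s
    using t[of "(fst (act m q (linv gen_a) s) - \<rho> i, snd (act m q (linv gen_a) s))"]
      valid_act[OF that, of "linv gen_a"]
    by (simp add: sh_def k_def algebra_simps)
  have u': "acts m q (winv (tower m \<rho> (Suc i))) s = act m q gen_a (sh (- k) (act m q (linv gen_a) s))"
    if "valid m q s" for s
    using acts_winv_shift[OF assms(1) q t valid_act[OF that], where x1 = "linv gen_a"]
    by (simp add: sh_def k_def winv_append winv_Cons algebra_simps)
  have cres: "cres q 1 = 1" "cres q (-1) = -1" "cres q (q * j + 1) = 1" for j
    using assms(2) cres_add_mult[of q 1 j] by (auto simp: cres_small add.commute)
  \<comment> \<open>The inverse tower leaves \<open>c\<close> behind its letter a and carries
    \<open>j\<close> across. When the tower is applied afterwards, the exponent m j + k equals -c,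
    again not divisible by m.\<close>
  define c j where "c = (- k) mod m" and "j = (- k) div m"
  have c0: "c \<noteq> 0" using k by (auto simp: c_def dvd_eq_mod_eq_0[symmetric])
  have c0': "(- c) mod m \<noteq> 0"
    using k unfolding c_def by (metis dvd_minus_iff mod_0_imp_dvd mod_minus_eq minus_minus dvd_imp_mod_0)
  have jk: "m * j + k = - c"
    using mult_div_mod_eq[of m "- k"] unfolding c_def j_def by linarith
  have s1: "acts m q (winv (tower m \<rho> (Suc i))) (-1, []) = (q * j, [(False, c), (True, -1)])"
    using u'[of "(-1, [])"] c0
    by (simp add: act_def linv_def gen_a_def push_def cres sh_def c_def j_def del: tower.simps)
  have "valid m q (q * j, [(False, c), (True, -1)])"
    unfolding s1[symmetric] by (rule valid_acts) simp
  then have "valid m q (q * j + 1, [(False, c), (True, -1)])" by simp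
  from u[OF this] have "acts m q (tower m \<rho> (Suc i)) (q * j + 1, [(False, c), (True, -1)])
      = act m q gen_a (- c, [(True, 1), (False, c), (True, -1)])"
    using q by (simp add: act_def linv_def gen_a_def push_def cres sh_def jk del: tower.simps)
  also have "\<dots> \<noteq> (0, [])"
    using c0' by (simp add: act_def gen_a_def push_def)
  finally show ?thesis
    unfolding mem_BS_iff[OF assms(1) q] comm_b_def by (simp add: s1 del: tower.simps)
qed

lemma abs_digit_less: "m \<noteq> 0 \<Longrightarrow> \<bar>digit m q i\<bar> < \<bar>m\<bar>"
  by (simp add: digit_def abs_mod_less)

lemma eventually_digit_eq:
  assumes "m \<noteq> 0" "x \<in> madic m"
  shows "\<forall>\<^sub>F q in class_filter m h (x h). \<forall>i<h. digit m (x h) i = digit m q i"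
  using eventually_class_filter_residue
proof eventually_elim
  case (elim q)
  then have "\<bar>m\<bar> ^ h dvd x h - q"
    using madic_range[OF assms(2), of h] by (metis mod_eq_dvd_iff mod_pos_pos_trivial)
  then have "m ^ h dvd x h - q" by (simp flip: power_abs)
  then show ?case using digit_cong[OF assms(1)] by blast
qed

text \<open>As y is a unit, different residues at level h force different digits among the first h.
  The commutator of the tower with the digits of x, stopped just after the first difference, is
  trivial for x and nontrivial for y.\<close>

lemma mg_dist_bs_limit_ge:
  assumes "\<bar>m\<bar> \<ge> 2" "x \<in> madic m" "y \<in> madic m" "coprime (y 1) m" "x h \<noteq> y h"
  shows "exp (- (2 * (real_of_int \<bar>m\<bar> + 1) * real h + 2 * real_of_int \<bar>m\<bar> + 6)) \<le> mg_dist (bs_limit m x) (bs_limit m y)"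
proof -
  have m: "m \<noteq> 0" using assms(1) by auto
  have "h \<noteq> 0"
    using assms(5) madic_range[OF assms(2), of 0] madic_range[OF assms(3), of 0] by (cases h) auto
  have cop: "coprime (y h) m"
  proof -
    have "y h mod \<bar>m\<bar> = y 1"
      using madic_mod[OF assms(3), of 1 h] \<open>h \<noteq> 0\<close> by simp
    then show ?thesis using assms(4) by (metis abs_eq_0_iff coprime_abs_right_iff coprime_mod_left_iff m)
  qed
  let ?D = "\<lambda>i. digit m (x h) i \<noteq> digit m (y h) i"
  have "\<exists>i<h. ?D i"
  proof (rule ccontr)
    assume "\<not> (\<exists>i<h. ?D i)"
    then have "m ^ h dvd y h - x h"
      using dvd_diff_if_digits_eq[OF cop] by blast
    then have "\<bar>m\<bar> ^ h dvd y h - x h" by (simp flip: power_abs)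
    then have "y h mod \<bar>m\<bar> ^ h = x h mod \<bar>m\<bar> ^ h" by (simp add: mod_eq_dvd_iff)
    then show False
      using assms(5) madic_range[OF assms(2), of h] madic_range[OF assms(3), of h] by simp
  qed
  \<comment> \<open>By minimality the tower below the last step is a power of b for both
    parameters.\<close>
  then obtain i where i: "i < h" "?D i" "\<And>j. j < i \<Longrightarrow> \<not> (j < h \<and> ?D j)"
    using exists_least_iff[of "\<lambda>i. i < h \<and> ?D i"] by blast
  define w where "w = reduce (comm_b (tower m (digit m (x h)) (Suc i)))"
  have big: "\<forall>\<^sub>F q in class_filter m h z. 2 < \<bar>q\<bar>" for z
    by (rule eventually_class_filter_gt)
  have "\<forall>\<^sub>F q in class_filter m h (x h). w \<in> BS m q"
    using big eventually_digit_eq[OF m assms(2)]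
  proof eventually_elim
    case (elim q)
    then show ?case
      using i(1) unfolding w_def by (intro comm_tower_in_BS m) auto
  qed
  then have wx: "w \<in> bs_limit m x"
    unfolding bs_limit_def w_def by auto
  have "\<forall>\<^sub>F q in class_filter m h (y h). w \<notin> BS m q"
    using big eventually_digit_eq[OF m assms(3)]
  proof eventually_elim
    case (elim q)
    have "digit m (x h) i mod m = digit m (x h) i" by (simp add: digit_def)
    then show ?case
      using i elim unfolding w_def by (intro comm_tower_not_in_BS m) auto
  qed
  then have wy: "w \<notin> bs_limit m y"
    by (rule not_mem_bs_limit[OF assms(3) m])
  \<comment> \<open>The base word has length |m| + 2; the commutator doubles the tower and adds b
    and its inverse, whence the constant 2|m| + 6.\<close>
  have "int (length w) \<le> 2 * int (length (tower m (digit m (x h)) (Suc i))) + 2"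
    using length_reduce_le[of "comm_b (tower m (digit m (x h)) (Suc i))"]
    unfolding w_def comm_b_def by simp
  also have "\<dots> \<le> 2 * ((\<bar>m\<bar> + 1) * int (Suc i) + \<bar>m\<bar> + 2) + 2"
    using length_tower[of "digit m (x h)" m "Suc i", OF abs_digit_less[OF m]]
    by (intro add_right_mono mult_left_mono) auto
  also have "\<dots> \<le> 2 * ((\<bar>m\<bar> + 1) * int h + \<bar>m\<bar> + 2) + 2"
    using i(1) by (intro add_mono mult_left_mono order_refl) auto
  finally have "real_of_int (int (length w)) \<le> real_of_int (2 * (\<bar>m\<bar> + 1) * int h + 2 * \<bar>m\<bar> + 6)"
    by (subst of_int_le_iff) (simp add: algebra_simps)
  then have "real (length w) \<le> 2 * (real_of_int \<bar>m\<bar> + 1) * real h + 2 * real_of_int \<bar>m\<bar> + 6"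
    by simp
  then have "exp (- (2 * (real_of_int \<bar>m\<bar> + 1) * real h + 2 * real_of_int \<bar>m\<bar> + 6)) \<le> exp (- real (length w))"
    by simp
  also have "\<dots> \<le> mg_dist (bs_limit m x) (bs_limit m y)"
    using wx wy by (intro mg_dist_ge) simp
  finally show ?thesis .
qed

section \<open>Hausdorff dimension\<close>

lemma mdiam_le:
  assumes "\<And>x y. x \<in> U \<Longrightarrow> y \<in> U \<Longrightarrow> d x y \<le> c"
  shows "mdiam d U \<le> ennreal c"
  unfolding mdiam_def by (intro SUP_least ennreal_leI assms)

lemma dist_le_mdiam: "x \<in> U \<Longrightarrow> y \<in> U \<Longrightarrow> ennreal (d x y) \<le> mdiam d U"
  unfolding mdiam_def by (rule SUP_upper2, assumption, rule SUP_upper)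

lemma hterm_le:
  assumes "mdiam d U \<le> ennreal c" "0 \<le> c" "0 < s"
  shows "hterm d s U \<le> ennreal (c powr s)"
proof -
  have "enn2real (mdiam d U) \<le> c"
    using assms(1,2) by (metis enn2real_ennreal enn2real_mono ennreal_less_top)
  then show ?thesis
    using assms(3) by (auto simp: hterm_def intro!: ennreal_leI powr_mono2)
qed

lemma suminf_ge_single: "f i \<le> (\<Sum>i. f i :: ennreal)"
  using sum_le_suminf[of f "{i}"] by simp

text \<open>The |m|^h classes of level h have diameter at most exp(-2h), so their cover sum is at
  most exp(-(2s - ln|m|) h), which tends to 0.\<close>

lemma hmeasure_bs_limit_eq_0:
  fixes m :: int
  assumes "\<bar>m\<bar> \<ge> 2" "ln \<bar>m\<bar> / 2 < s" "X \<subseteq> madic m"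
  shows "hmeasure mg_dist s (bs_limit m ` X) = 0"
proof -
  have m: "m \<noteq> 0" using assms(1) by auto
  have s: "0 < s" using assms(1,2) by (smt (verit) divide_nonneg_nonneg ln_ge_zero of_int_1_le_iff)
  define c where "c = 2 * s - ln \<bar>m\<bar>"
  have c: "0 < c" using assms(2) by (simp add: c_def)
  have bound: "hcontent mg_dist s \<delta> (bs_limit m ` X) \<le> 0 + ennreal \<epsilon>" if "\<delta> > 0" "\<epsilon> > 0" for \<delta> \<epsilon>
  proof -
    obtain h where h: "max (- ln \<delta> / 2) (- ln \<epsilon> / c) < real h"
      using reals_Archimedean2 by blast
    have "- ln \<delta> < 2 * real h" using h by (simp add: field_simps)
    then have h1: "exp (- 2 * real h) \<le> \<delta>"
      using that(1) by (subst ln_ge_iff[symmetric]) auto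
    have "- ln \<epsilon> < c * real h" using h c by (simp add: field_simps)
    then have h2: "exp (- c * real h) \<le> \<epsilon>"
      using that(2) by (subst ln_ge_iff[symmetric]) auto
    define n where "n = nat (\<bar>m\<bar> ^ h)"
    have n: "real n = real_of_int \<bar>m\<bar> ^ h" by (simp add: n_def)
    \<comment> \<open>The finite cover is padded with empty sets, to which \<open>hterm\<close>
      assigns 0.\<close>
    define U where "U = (\<lambda>i. if i < n then bs_limit m ` {x \<in> X. x h = int i} else {})"
    have diam: "mdiam mg_dist (U i) \<le> ennreal (exp (- 2 * real h))" for i
    proof (rule mdiam_le)
      fix M N assume "M \<in> U i" "N \<in> U i"
      then obtain x y where "x \<in> X" "y \<in> X" "x h = y h" "M = bs_limit m x" "N = bs_limit m y"
        by (auto simp: U_def split: if_splits)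
      then show "mg_dist M N \<le> exp (- 2 * real h)"
        using mg_dist_bs_limit_le[of x m y h] assms(3) m by auto
    qed
    have cover: "bs_limit m ` X \<subseteq> (\<Union>i. U i)"
    proof
      fix N assume "N \<in> bs_limit m ` X"
      then obtain x where x: "x \<in> X" "N = bs_limit m x" by blast
      have "0 \<le> x h" "x h < \<bar>m\<bar> ^ h" using madic_range assms(3) x by blast+
      then have "N \<in> U (nat (x h))" using x m by (auto simp: U_def n_def nat_less_iff)
      then show "N \<in> (\<Union>i. U i)" by blast
    qed
    have "hcontent mg_dist s \<delta> (bs_limit m ` X) \<le> (\<Sum>i. hterm mg_dist s (U i))"
      unfolding hcontent_def
    proof (rule Inf_lower, intro CollectI exI[of _ U] conjI refl cover allI)
      show "mdiam mg_dist (U i) \<le> ennreal \<delta>" for i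
        by (rule order_trans[OF diam ennreal_leI[OF h1]])
    qed
    also have "\<dots> = (\<Sum>i<n. hterm mg_dist s (U i))"
      by (rule suminf_finite) (auto simp: U_def hterm_def)
    also have "\<dots> \<le> (\<Sum>i<n. ennreal (exp (- 2 * real h) powr s))"
      by (intro sum_mono hterm_le diam s) auto
    also have "\<dots> = ennreal (real n * exp (- 2 * real h) powr s)"
      by (simp add: ennreal_mult ennreal_of_nat_eq_real_of_nat)
    also have "real n * exp (- 2 * real h) powr s = exp (real h * ln \<bar>m\<bar>) * exp (- 2 * real h * s)"
      unfolding n using m by (simp add: exp_of_nat_mult powr_def mult.commute)
    also have "\<dots> = exp (- c * real h)"
      by (simp add: c_def algebra_simps flip: exp_add)
    finally show ?thesis
      using h2 by (auto intro: order_trans ennreal_leI)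
  qed
  have "hcontent mg_dist s \<delta> (bs_limit m ` X) \<le> 0" if "\<delta> > 0" for \<delta>
    by (rule ennreal_le_epsilon) (rule bound[OF that])
  then have "hmeasure mg_dist s (bs_limit m ` X) \<le> 0"
    unfolding hmeasure_def by (intro SUP_least) simp
  then show ?thesis by simp
qed

text \<open>Descending the tree of residues, one always finds a child of small enough total weight;
  the resulting m-adic integer would be left uncovered.\<close>

lemma madic_cover_weight:
  fixes m :: int and h :: "nat \<Rightarrow> nat" and v :: "nat \<Rightarrow> int"
  assumes m: "\<bar>m\<bar> \<ge> 2"
    and cover: "\<And>z. z \<in> madic m \<Longrightarrow> z 1 = 1 \<Longrightarrow> \<exists>i. z (h i) = v i"
  shows "ennreal (1 / \<bar>m\<bar>) \<le> (\<Sum>i. ennreal (1 / \<bar>m\<bar> ^ h i))"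
proof (rule ccontr)
  assume "\<not> ?thesis"
  then have less: "(\<Sum>i. ennreal (1 / \<bar>m\<bar> ^ h i)) < ennreal (1 / \<bar>m\<bar>)" by simp
  define w where "w i = ennreal (1 / \<bar>m\<bar> ^ h i)" for i
  \<comment> \<open>The total weight of the given cylinders, v i modulo |m|^(h i), that are
    contained in the class of u modulo |m|^k.\<close>
  define W where "W k u = (\<Sum>i. if k \<le> h i \<and> v i mod \<bar>m\<bar> ^ k = u then w i else 0)" for k u
  have pos: "0 < \<bar>m\<bar> ^ k" for k using m by auto
  \<comment> \<open>A cylinder inside a child of u lies inside u and in only one child; cylinders of
    level exactly k lie in none.\<close>
  have split: "(\<Sum>c\<in>{0..<\<bar>m\<bar>}. if Suc k \<le> h i \<and> v i mod \<bar>m\<bar> ^ Suc k = u + \<bar>m\<bar> ^ k * c then w i else 0)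
      \<le> (if k \<le> h i \<and> v i mod \<bar>m\<bar> ^ k = u then w i else 0)" if "0 \<le> u" "u < \<bar>m\<bar> ^ k" for k u i
  proof (cases "Suc k \<le> h i \<and> v i mod \<bar>m\<bar> ^ k = u")
    case True
    define c0 where "c0 = (v i mod \<bar>m\<bar> ^ Suc k - u) div \<bar>m\<bar> ^ k"
    have "(\<Sum>c\<in>{0..<\<bar>m\<bar>}. if Suc k \<le> h i \<and> v i mod \<bar>m\<bar> ^ Suc k = u + \<bar>m\<bar> ^ k * c then w i else 0)
        \<le> (\<Sum>c\<in>{0..<\<bar>m\<bar>}. if c0 = c then w i else 0)"
      using pos[of k] by (intro sum_mono) (auto simp: c0_def)
    also have "\<dots> \<le> w i" by simp
    finally show ?thesis using True by simp
  next
    case False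
    have "v i mod \<bar>m\<bar> ^ k = u" if "v i mod \<bar>m\<bar> ^ Suc k = u + \<bar>m\<bar> ^ k * c" for c
    proof -
      have "v i mod \<bar>m\<bar> ^ k = v i mod \<bar>m\<bar> ^ Suc k mod \<bar>m\<bar> ^ k"
        by (rule mod_mod_cancel[symmetric]) simp
      then show ?thesis using that \<open>0 \<le> u\<close> \<open>u < \<bar>m\<bar> ^ k\<close> by simp
    qed
    with False have "(\<Sum>c\<in>{0..<\<bar>m\<bar>}. if Suc k \<le> h i \<and> v i mod \<bar>m\<bar> ^ Suc k = u + \<bar>m\<bar> ^ k * c then w i else 0) = 0"
      by (intro sum.neutral) auto
    then show ?thesis by simp
  qed
  have child: "\<exists>c\<in>{0..<\<bar>m\<bar>}. W (Suc k) (u + \<bar>m\<bar> ^ k * c) < ennreal (1 / \<bar>m\<bar> ^ Suc k)"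
    if u: "0 \<le> u" "u < \<bar>m\<bar> ^ k" and W: "W k u < ennreal (1 / \<bar>m\<bar> ^ k)" for k u
  proof (rule ccontr)
    assume "\<not> ?thesis"
    then have ge: "ennreal (1 / \<bar>m\<bar> ^ Suc k) \<le> W (Suc k) (u + \<bar>m\<bar> ^ k * c)" if "c \<in> {0..<\<bar>m\<bar>}" for c
      using that by (auto simp: not_less)
    have "ennreal (1 / \<bar>m\<bar> ^ k) = (\<Sum>c\<in>{0..<\<bar>m\<bar>}. ennreal (1 / \<bar>m\<bar> ^ Suc k))"
      using m by (simp add: ennreal_of_nat_eq_real_of_nat flip: ennreal_mult)
    also have "\<dots> \<le> (\<Sum>c\<in>{0..<\<bar>m\<bar>}. W (Suc k) (u + \<bar>m\<bar> ^ k * c))"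
      by (intro sum_mono ge)
    also have "\<dots> = (\<Sum>i. \<Sum>c\<in>{0..<\<bar>m\<bar>}.
        if Suc k \<le> h i \<and> v i mod \<bar>m\<bar> ^ Suc k = u + \<bar>m\<bar> ^ k * c then w i else 0)"
      unfolding W_def by (rule suminf_sum[symmetric]) simp
    also have "\<dots> \<le> W k u"
      unfolding W_def by (intro suminf_le split[OF u]) auto
    finally show False using W by simp
  qed
  \<comment> \<open>The descent starts in the class of 1 modulo |m|, whose mass is the bound
    1/|m|.\<close>
  have W1: "W 1 1 < ennreal (1 / \<bar>m\<bar> ^ 1)"
  proof -
    have "W 1 1 \<le> (\<Sum>i. w i)"
      unfolding W_def by (intro suminf_le) auto
    with less show ?thesis by (simp add: w_def)
  qed
  have "\<exists>f. \<forall>n. (W (Suc n) (f n) < ennreal (1 / \<bar>m\<bar> ^ Suc n) \<and> 0 \<le> f n \<and> f n < \<bar>m\<bar> ^ Suc n \<and> (n = 0 \<longrightarrow> f n = 1))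
      \<and> f (Suc n) mod \<bar>m\<bar> ^ Suc n = f n"
  proof (rule dependent_nat_choice)
    show "\<exists>x. W (Suc 0) x < ennreal (1 / \<bar>m\<bar> ^ Suc 0) \<and> 0 \<le> x \<and> x < \<bar>m\<bar> ^ Suc 0 \<and> (0 = (0::nat) \<longrightarrow> x = 1)"
      using W1 m by (intro exI[of _ 1]) simp
  next
    fix u n
    assume "W (Suc n) u < ennreal (1 / \<bar>m\<bar> ^ Suc n) \<and> 0 \<le> u \<and> u < \<bar>m\<bar> ^ Suc n \<and> (n = 0 \<longrightarrow> u = 1)"
    then have u: "0 \<le> u" "u < \<bar>m\<bar> ^ Suc n" "W (Suc n) u < ennreal (1 / \<bar>m\<bar> ^ Suc n)" by auto
    from child[OF this] obtain c where c: "0 \<le> c" "c < \<bar>m\<bar>"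
      "W (Suc (Suc n)) (u + \<bar>m\<bar> ^ Suc n * c) < ennreal (1 / \<bar>m\<bar> ^ Suc (Suc n))" by auto
    have "u + \<bar>m\<bar> ^ Suc n * c < \<bar>m\<bar> ^ Suc n + \<bar>m\<bar> ^ Suc n * (\<bar>m\<bar> - 1)"
      using u c by (intro add_less_le_mono mult_left_mono) auto
    also have "\<dots> = \<bar>m\<bar> ^ Suc (Suc n)" by (simp add: algebra_simps)
    finally show "\<exists>y. (W (Suc (Suc n)) y < ennreal (1 / \<bar>m\<bar> ^ Suc (Suc n)) \<and> 0 \<le> y \<and> y < \<bar>m\<bar> ^ Suc (Suc n)
        \<and> (Suc n = 0 \<longrightarrow> y = 1)) \<and> y mod \<bar>m\<bar> ^ Suc n = u"
      using u c by (intro exI[of _ "u + \<bar>m\<bar> ^ Suc n * c"] conjI) (auto simp del: power_Suc)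
  qed
  then obtain f where fW: "\<And>n. W (Suc n) (f n) < ennreal (1 / \<bar>m\<bar> ^ Suc n)"
    and f: "\<And>n. 0 \<le> f n" "\<And>n. f n < \<bar>m\<bar> ^ Suc n" "f 0 = 1" "\<And>n. f (Suc n) mod \<bar>m\<bar> ^ Suc n = f n"
    by blast
  \<comment> \<open>\<open>f n\<close> lives at level n + 1; level 0 has the single residue
    0.\<close>
  define z where "z k = (case k of 0 \<Rightarrow> 0 | Suc n \<Rightarrow> f n)" for k
  have "z \<in> madic m"
    unfolding madic_def using f by (auto simp: z_def split: nat.splits simp del: power_Suc)
  moreover have "z 1 = 1" by (simp add: z_def f)
  ultimately obtain i where i: "z (h i) = v i" using cover by blast
  show False
  \<comment> \<open>A cylinder of level 0 alone has weight 1, beyond the assumed total. Otherwise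
    the class reached at level \<open>h i\<close> is cylinder i itself, whose weight contradicts the
    bound kept along the path.\<close>
  proof (cases "h i")
    case 0
    have "1 \<le> (\<Sum>i. ennreal (1 / \<bar>m\<bar> ^ h i))"
      using suminf_ge_single[of "\<lambda>i. ennreal (1 / \<bar>m\<bar> ^ h i)" i] 0 by simp
    also note less
    also have "ennreal (1 / \<bar>m\<bar>) \<le> 1" using m by (intro ennreal_le_1[THEN iffD2]) simp
    finally show False by simp
  next
    case (Suc n)
    then have "v i = f n" using i by (simp add: z_def)
    then have "w i \<le> W (Suc n) (f n)"
      unfolding W_def using Suc f(1,2)[of n]
        suminf_ge_single[of "\<lambda>j. if Suc n \<le> h j \<and> v j mod \<bar>m\<bar> ^ Suc n = f n then w j else 0" i]
      by (simp del: power_Suc)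
    with fW[of n] show False by (simp add: w_def Suc)
  qed
qed

text \<open>Trades an arbitrary covering set for a residue class: the class ends just before the
  parameters in \<open>U\<close> first disagree, and that disagreement bounds the diameter from
  below. In \<open>C\<close> the exponential absorbs the additive constant of the distance bound,
  and the factor |m| the one level lost.\<close>

lemma cover_set_in_cylinder:
  fixes m :: int
  assumes m: "\<bar>m\<bar> \<ge> 2" and s: "0 \<le> s" "s \<le> ln \<bar>m\<bar> / (2 * (real_of_int \<bar>m\<bar> + 1))" and \<epsilon>: "\<epsilon> > 0"
  defines "C \<equiv> real_of_int \<bar>m\<bar> * exp (ln \<bar>m\<bar> / (2 * (real_of_int \<bar>m\<bar> + 1)) * (2 * real_of_int \<bar>m\<bar> + 6))"
  shows "\<exists>h v. (\<forall>z\<in>madic m. z 1 = 1 \<longrightarrow> bs_limit m z \<in> U \<longrightarrow> z h = v)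
           \<and> ennreal (1 / \<bar>m\<bar> ^ h) \<le> ennreal C * hterm mg_dist s U + ennreal \<epsilon>"
proof -
  define Z where "Z = {z \<in> madic m. z 1 = 1 \<and> bs_limit m z \<in> U}"
  define M where "M = real_of_int \<bar>m\<bar>"
  have M: "M \<ge> 2" using m by (simp add: M_def)
  show ?thesis
  proof (cases "\<exists>h. \<exists>x\<in>Z. \<exists>y\<in>Z. x h \<noteq> y h")
    \<comment> \<open>At most one parameter is involved and the diameter may be 0, so a deep level
      is chosen and \<open>\<epsilon>\<close> alone pays for it.\<close>
    case False
    have "(\<lambda>h. (1 / M) ^ h) \<longlonglongrightarrow> 0"
      using M by (intro LIMSEQ_power_zero) auto
    then have "\<forall>\<^sub>F h in sequentially. (1 / M) ^ h < \<epsilon>"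
      using \<epsilon> by (rule order_tendstoD)
    then obtain h where h: "(1 / M) ^ h < \<epsilon>"
      by (auto simp: eventually_sequentially)
    obtain v where "\<forall>z\<in>Z. z h = v" using False by blast
    moreover have "ennreal (1 / \<bar>m\<bar> ^ h) \<le> ennreal \<epsilon>"
      using h by (intro ennreal_leI) (simp add: M_def power_one_over)
    ultimately show ?thesis
      by (intro exI[of _ h] exI[of _ v]) (auto simp: Z_def intro: order_trans add_increasing)
  next
    case True
    then obtain h where h: "\<exists>x\<in>Z. \<exists>y\<in>Z. x h \<noteq> y h"
      and min: "\<And>k. k < h \<Longrightarrow> \<not> (\<exists>x\<in>Z. \<exists>y\<in>Z. x k \<noteq> y k)"
      using exists_least_iff[of "\<lambda>h. \<exists>x\<in>Z. \<exists>y\<in>Z. x h \<noteq> y h"] by blast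
    from h obtain x y where xy: "x \<in> Z" "y \<in> Z" "x h \<noteq> y h" by blast
    have "h \<noteq> 0"
      using xy(3) madic_range[of x m 0] madic_range[of y m 0] xy(1,2) by (cases h) (auto simp: Z_def)
    then obtain g where g: "h = Suc g" by (cases h) auto
    \<comment> \<open>The exponent that turns a distance of order exp(-2(M + 1)h) into the mass
      M^(-h).\<close>
    define L where "L = ln M / (2 * (M + 1))"
    define \<beta> where "\<beta> = 2 * M + 6"
    define d where "d = enn2real (mdiam mg_dist U)"
    have C: "C = M * exp (L * \<beta>)" by (simp add: C_def M_def L_def \<beta>_def)
    have "mdiam mg_dist U \<le> ennreal 1"
      by (rule mdiam_le) (rule mg_dist_le_1)
    then have d: "mdiam mg_dist U = ennreal d"
      unfolding d_def by (metis ennreal_enn2real ennreal_less_top le_less_trans)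
    have "ennreal (mg_dist (bs_limit m x) (bs_limit m y)) \<le> ennreal d"
      using dist_le_mdiam[of "bs_limit m x" U "bs_limit m y" mg_dist] xy d by (auto simp: Z_def)
    then have dist: "mg_dist (bs_limit m x) (bs_limit m y) \<le> d"
      by (subst (asm) ennreal_le_iff) (simp_all add: d_def)
    moreover have "exp (- (2 * (M + 1) * real h + \<beta>)) \<le> mg_dist (bs_limit m x) (bs_limit m y)"
      using mg_dist_bs_limit_ge[OF m, of x y h] xy by (auto simp: Z_def M_def \<beta>_def add.assoc)
    ultimately have exp_le: "exp (- (2 * (M + 1) * real h + \<beta>)) \<le> d" by linarith
    \<comment> \<open>Since the lower bound for the diameter is at most 1, raising s to
      \<open>L\<close> only decreases it; for s = 0 the value 1 of \<open>hterm\<close> on nonempty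
      sets enters.\<close>
    have hterm: "ennreal (exp (- L * (2 * (M + 1) * real h + \<beta>))) \<le> hterm mg_dist s U"
    proof (cases "s = 0")
      case True
      have "L \<ge> 0" "\<beta> \<ge> 0" using M by (auto simp: L_def \<beta>_def)
      then have "- L * (2 * (M + 1) * real h + \<beta>) \<le> 0" using M by (simp add: add_nonneg_nonneg)
      then show ?thesis using xy True by (auto simp: hterm_def Z_def simp del: mult_minus_left)
    next
      case False
      have "exp (- L * (2 * (M + 1) * real h + \<beta>)) \<le> exp (- s * (2 * (M + 1) * real h + \<beta>))"
        using s M unfolding exp_le_cancel_iff
        by (intro mult_right_mono) (auto simp: L_def M_def \<beta>_def)
      also have "\<dots> = exp (- (2 * (M + 1) * real h + \<beta>)) powr s"
        by (simp add: powr_def algebra_simps)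
      also have "\<dots> \<le> d powr s"
        using s(1) exp_le by (intro powr_mono2) auto
      finally show ?thesis
        using xy False by (auto simp: hterm_def Z_def d_def intro: ennreal_leI)
    qed
    have "1 / M ^ g = C * exp (- L * (2 * (M + 1) * real h + \<beta>))"
    proof -
      have "L * (2 * (M + 1)) = ln M" using M by (simp add: L_def)
      moreover have "- L * (2 * (M + 1) * real h + \<beta>) = - (real h * (L * (2 * (M + 1)))) - L * \<beta>"
        by (simp add: algebra_simps)
      ultimately have "- L * (2 * (M + 1) * real h + \<beta>) = - (real h * ln M) - L * \<beta>"
        by simp
      then have "C * exp (- L * (2 * (M + 1) * real h + \<beta>)) = M * exp (- (real h * ln M))"
        by (simp add: C exp_diff)
      also have "\<dots> = M / M ^ h"
        using M by (simp add: exp_minus exp_of_nat_mult field_simps)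
      finally show ?thesis using M by (simp add: g)
    qed
    then have "ennreal (1 / M ^ g) = ennreal C * ennreal (exp (- L * (2 * (M + 1) * real h + \<beta>)))"
      using M by (simp add: C ennreal_mult)
    also have "\<dots> \<le> ennreal C * hterm mg_dist s U + ennreal \<epsilon>"
      using mult_left_mono[OF hterm, of "ennreal C"] by (simp add: add_increasing2)
    finally have "ennreal (1 / \<bar>m\<bar> ^ g) \<le> ennreal C * hterm mg_dist s U + ennreal \<epsilon>"
      by (simp add: M_def)
    moreover have "\<forall>z\<in>Z. z g = x g" using min[of g] xy(1) g by auto
    ultimately show ?thesis
      by (intro exI[of _ g] exI[of _ "x g"]) (auto simp: Z_def)
  qed
qed

text \<open>The boundary value of s is included, as cover sums stay above a fixed positive constant.
  The class of 1 consists of units for every m, composite ones included, and already carries enough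
  mass.\<close>

lemma hmeasure_bs_limit_neq_0:
  fixes m :: int
  assumes m: "\<bar>m\<bar> \<ge> 2" and s: "0 \<le> s" "s \<le> ln \<bar>m\<bar> / (2 * (real_of_int \<bar>m\<bar> + 1))"
    and X: "\<And>z. z \<in> madic m \<Longrightarrow> z 1 = 1 \<Longrightarrow> z \<in> X"
  shows "hmeasure mg_dist s (bs_limit m ` X) \<noteq> 0"
proof -
  define M where "M = real_of_int \<bar>m\<bar>"
  have M: "M \<ge> 2" using m by (simp add: M_def)
  define C where "C = M * exp (ln M / (2 * (M + 1)) * (2 * M + 6))"
  have C: "C > 0" using M by (simp add: C_def)
  have ge: "ennreal (1 / (2 * M * C)) \<le> (\<Sum>i. hterm mg_dist s (U i))"
    if cover: "bs_limit m ` X \<subseteq> (\<Union>i. U i)" for U :: "nat \<Rightarrow> word set set"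
  proof -
    \<comment> \<open>These errors add up to half the mass 1/M of the class of 1.\<close>
    let ?\<epsilon> = "\<lambda>i. 1 / (2 * M) * (1 / 2) ^ Suc i"
    let ?S = "\<Sum>i. hterm mg_dist s (U i)"
    have "\<exists>h v. (\<forall>z\<in>madic m. z 1 = 1 \<longrightarrow> bs_limit m z \<in> U i \<longrightarrow> z h = v)
           \<and> ennreal (1 / \<bar>m\<bar> ^ h) \<le> ennreal C * hterm mg_dist s (U i) + ennreal (?\<epsilon> i)" for i
      using cover_set_in_cylinder[OF m s, of "?\<epsilon> i" "U i"] M by (simp add: C_def M_def)
    then obtain h v where hv: "\<And>i z. z \<in> madic m \<Longrightarrow> z 1 = 1 \<Longrightarrow> bs_limit m z \<in> U i \<Longrightarrow> z (h i) = v i"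
      and le: "\<And>i. ennreal (1 / \<bar>m\<bar> ^ h i) \<le> ennreal C * hterm mg_dist s (U i) + ennreal (?\<epsilon> i)"
      by metis
    have "\<exists>i. z (h i) = v i" if "z \<in> madic m" "z 1 = 1" for z
      using hv[OF that] cover X[OF that] by blast
    then have "ennreal (1 / M) \<le> (\<Sum>i. ennreal (1 / \<bar>m\<bar> ^ h i))"
      unfolding M_def by (rule madic_cover_weight[OF m])
    also have "\<dots> \<le> (\<Sum>i. ennreal C * hterm mg_dist s (U i) + ennreal (?\<epsilon> i))"
      by (intro suminf_le le) auto
    also have "\<dots> = ennreal C * ?S + (\<Sum>i. ennreal (?\<epsilon> i))"
      by (subst suminf_add[symmetric]) auto
    also have "(\<Sum>i. ennreal (?\<epsilon> i)) = ennreal (1 / (2 * M))"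
    proof (rule suminf_ennreal_eq)
      show "?\<epsilon> sums (1 / (2 * M))"
        using sums_mult[OF power_half_series, of "1 / (2 * M)"] by simp
    qed (use M in auto)
    finally have main: "ennreal (1 / M) \<le> ennreal C * ?S + ennreal (1 / (2 * M))" .
    show ?thesis
    proof (cases ?S)
      case (real r)
      have "ennreal (1 / M) \<le> ennreal (C * r + 1 / (2 * M))"
        using main real C M by (simp add: ennreal_mult)
      then have "1 / M \<le> C * r + 1 / (2 * M)"
        using real C M by (subst (asm) ennreal_le_iff) auto
      then have "1 / (2 * M * C) \<le> r"
        using C M by (simp add: field_simps)
      then show ?thesis
        unfolding real(2) by (rule ennreal_leI)
    qed simp
  qed
  have "0 < ennreal (1 / (2 * M * C))"
    using C M by (simp add: ennreal_less_zero_iff)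
  \<comment> \<open>The bound holds for covers of any diameter, so a single \<delta> serves to bound
    the supremum from below.\<close>
  also have "\<dots> \<le> hcontent mg_dist s 1 (bs_limit m ` X)"
    unfolding hcontent_def using ge by (intro Inf_greatest) blast
  also have "\<dots> \<le> hmeasure mg_dist s (bs_limit m ` X)"
    unfolding hmeasure_def by (intro SUP_upper) simp
  finally show ?thesis by simp
qed

theorem theorem6p6:
  fixes m :: int
  assumes "\<bar>m\<bar> \<ge> 2"
  shows "ereal (ln (real_of_int \<bar>m\<bar>) / (2 * (real_of_int \<bar>m\<bar> + 1)))
           \<le> hdim mg_dist (barBS m ` madic_units m)
         \<and> hdim mg_dist (barBS m ` madic_units m) \<le> ereal (ln (real_of_int \<bar>m\<bar>) / 2)"
proof -
  have units: "madic_units m \<subseteq> madic m" by (auto simp: madic_units_def)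
  have eq: "barBS m ` madic_units m = bs_limit m ` madic_units m"
    using barBS_eq_bs_limit[OF _ assms] units by (intro image_cong) auto
  have units1: "z \<in> madic_units m" if "z \<in> madic m" "z 1 = 1" for z
    using that by (simp add: madic_units_def)
  have "ereal (ln \<bar>m\<bar> / (2 * (real_of_int \<bar>m\<bar> + 1))) \<le> hdim mg_dist (bs_limit m ` madic_units m)"
    unfolding hdim_def
  proof (rule Inf_greatest)
    fix t assume "t \<in> {ereal s | s. 0 \<le> s \<and> hmeasure mg_dist s (bs_limit m ` madic_units m) = 0}"
    then obtain s where "t = ereal s" "0 \<le> s" "hmeasure mg_dist s (bs_limit m ` madic_units m) = 0"
      by blast
    then show "ereal (ln \<bar>m\<bar> / (2 * (real_of_int \<bar>m\<bar> + 1))) \<le> t"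
      using hmeasure_bs_limit_neq_0[OF assms, of s "madic_units m", OF _ _ units1] by fastforce
  qed
  moreover have "hdim mg_dist (bs_limit m ` madic_units m) \<le> ereal (ln \<bar>m\<bar> / 2)"
  proof (rule ereal_le_epsilon2)
    fix e :: real assume "0 < e"
    then have "ln \<bar>m\<bar> / 2 < ln \<bar>m\<bar> / 2 + e" by simp
    moreover have "0 \<le> ln \<bar>m\<bar> / 2 + e" using assms \<open>0 < e\<close> by simp
    ultimately have "hdim mg_dist (bs_limit m ` madic_units m) \<le> ereal (ln \<bar>m\<bar> / 2 + e)"
      unfolding hdim_def using hmeasure_bs_limit_eq_0[OF assms _ units] by (intro Inf_lower) blast
    then show "hdim mg_dist (bs_limit m ` madic_units m) \<le> ereal (ln \<bar>m\<bar> / 2) + ereal e"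
      by simp
  qed
  ultimately show ?thesis
    unfolding eq by blast
qed

end
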